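(* Let $C_1,c_1,\gamma>0$, let $E$ be an $m\times n$ real random matrix that is $(C_1,c_1,\gamma)$-concentrated, and let $A$ be a deterministic real $m\times n$ matrix of rank $r$. Let $\delta=\sigma_1-\sigma_2$. Then, for any $t>0$, $$\sin\angle(v_1,v_1')\le4\sqrt2\left(\frac{t\,r^{1/\gamma}}{\delta}+\frac{\|E\|}{\sigma_1}+\frac{\|E\|^2}{\sigma_1\delta}\right)$$ with probability at least $$1-54\,C_1\exp\left(-c_1\frac{\delta^\gamma}{8^\gamma}\right)-2C_1\,9^{2r}\exp\left(-c_1r\frac{t^\gamma}{4^\gamma}\right).$$
   Context: An $m\times n$ random matrix $E$ is $(C_1,c_1,\gamma)$-concentrated if for all unit vectors $u\in\mathbb R^m$, $v\in\mathbb R^n$ and every $t>0$, $\mathbb P(|u^{\mathrm T}Ev|>t)\le C_1\exp(-c_1t^\gamma)$. $\|\cdot\|$ is the spectral norm. $\sigma_1\ge\sigma_2\ge\cdots\ge\sigma_{\min\{m,n\}}\ge0$ are the singular values of $A$, with $\sigma_k:=0$ for $k>\min\{m,n\}$. $v_1$ is a unit singular vector of $A$ for its largest singular value and $v_1'$ a unit singular vector of $A+E$ for its largest singular value (any choice). "Singular vector" may be read as left-singular or as right-singular, the same choice being made for $A$ and $A+E$; the result holds for either choice. For unit vectors, $\angle(v,v')\in[0,\pi/2]$ and $\sin\angle(v,v')=\sqrt{1-(v\cdot v')^2}$. A quotient with zero denominator is read as $+\infty$ (so the bound is vacuous when $\delta=0$). *)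

theory Defs
  imports "HOL-Probability.Probability" "HOL-Library.Multiset"
begin

definition concentrated ::
    "'a measure \<Rightarrow> ('a \<Rightarrow> real^'n^'m) \<Rightarrow> real \<Rightarrow> real \<Rightarrow> real \<Rightarrow> bool" where
  "concentrated M E C\<^sub>1 c\<^sub>1 \<gamma> \<longleftrightarrow>
     (\<forall>(u::real^'m) (v::real^'n) t. norm u = 1 \<longrightarrow> norm v = 1 \<longrightarrow> t > 0 \<longrightarrow>
        measure M {\<omega> \<in> space M. \<bar>u \<bullet> (E \<omega> *v v)\<bar> > t} \<le> C\<^sub>1 * exp (- c\<^sub>1 * t powr \<gamma>))"

definition spectral_norm :: "real^'n^'m \<Rightarrow> real" where
  "spectral_norm A = onorm (\<lambda>x. A *v x)"

definition eigenspace :: "real^'n^'n \<Rightarrow> real \<Rightarrow> (real^'n) set" where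
  "eigenspace S \<mu> = {x. S *v x = \<mu> *\<^sub>R x}"

definition eigenvalues :: "real^'n^'n \<Rightarrow> real set" where
  "eigenvalues S = {\<mu>. \<exists>x. x \<noteq> 0 \<and> x \<in> eigenspace S \<mu>}"

text \<open>
  Square roots of the eigenvalues of the Gram matrix, with multiplicity. The Gram matrix is
  symmetric, so geometric and algebraic multiplicities agree, there are \<open>CARD('n)\<close> entries in
  total, and all but the \<open>min CARD('m) CARD('n)\<close> largest of them are zero.
\<close>

definition singular_value_mset :: "real^'n^'m \<Rightarrow> real multiset" where
  "singular_value_mset A =
     (\<Sum>\<mu>\<in>eigenvalues (transpose A ** A).
        replicate_mset (dim (eigenspace (transpose A ** A) \<mu>)) (sqrt \<mu>))"

text \<open>The index \<open>k\<close> starts at 1.\<close>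

definition singular_value :: "real^'n^'m \<Rightarrow> nat \<Rightarrow> real" where
  "singular_value A k =
     (if 1 \<le> k \<and> k \<le> min CARD('m) CARD('n)
      then rev (sorted_list_of_multiset (singular_value_mset A)) ! (k - 1)
      else 0)"

definition singular_pair :: "real^'n^'m \<Rightarrow> real \<Rightarrow> real^'m \<Rightarrow> real^'n \<Rightarrow> bool" where
  "singular_pair A \<sigma> u v \<longleftrightarrow>
     norm u = 1 \<and> norm v = 1 \<and> A *v v = \<sigma> *\<^sub>R u \<and> transpose A *v u = \<sigma> *\<^sub>R v"

definition top_left_singular_vector :: "real^'n^'m \<Rightarrow> real^'m \<Rightarrow> bool" where
  "top_left_singular_vector A u \<longleftrightarrow> (\<exists>v. singular_pair A (singular_value A 1) u v)"

definition top_right_singular_vector :: "real^'n^'m \<Rightarrow> real^'n \<Rightarrow> bool" where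
  "top_right_singular_vector A v \<longleftrightarrow> (\<exists>u. singular_pair A (singular_value A 1) u v)"

text \<open>Sine of the angle in \<open>[0, \<pi>/2]\<close> between the lines spanned by two unit vectors.\<close>

definition sin_angle :: "'v::real_inner \<Rightarrow> 'v \<Rightarrow> real" where
  "sin_angle v v' = sqrt (1 - (v \<bullet> v')\<^sup>2)"

text \<open>
  Unlike division on \<^typ>\<open>ereal\<close>, where \<open>0 / 0 = 0\<close>, every quotient with denominator 0 is
  infinite here.
\<close>

definition equot :: "real \<Rightarrow> real \<Rightarrow> ereal" where
  "equot a b = (if b = 0 then \<infinity> else ereal (a / b))"

end

theory Submission
  imports Defs
begin

text \<open>
  Write \<open>\<sigma>'\<close> for the largest singular value of \<open>A + E\<close>, with singular vectors \<open>u'\<close>, \<open>v'\<close>.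
  Since \<open>\<sigma>' \<ge> u\<^sub>1 \<bullet> (A + E) v\<^sub>1 = \<sigma>\<^sub>1 + u\<^sub>1 \<bullet> E v\<^sub>1\<close>, one application of the concentration
  hypothesis gives \<open>\<sigma>' \<ge> \<sigma>\<^sub>1 - \<delta>/8\<close>. A union bound over nets of the unit balls of the column and
  row space of \<open>A\<close>, both of dimension \<open>r\<close>, bounds the bilinear form of \<open>E\<close> on these spaces by
  \<open>(9/4) t r\<^bsup>1/\<gamma>\<^esup>\<close>. On the intersection of these two events the estimate is
  deterministic.
\<close>

section \<open>Spectral theorem for self-adjoint operators\<close>

text \<open>Left and right vectors have to be estimated together: the bound for the row space error
  \<open>b\<close> contains \<open>\<sigma>2 * norm a\<close>, the one for the column space error
  \<open>a\<close> contains \<open>\<sigma>2 * norm b\<close>, and only their sum turns this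
  coupling into the gap. Off the row and column space only the operator norm of E is available. But
  A vanishes there, so these components already have size of order ||E|| / \<sigma>_1, and meeting E
  once more they cost just the term ||E||^2 / (\<sigma>_1 \<delta>). Constants: a 2/3-net loses a
  factor 1 / (1 - 2/3) = 3 on each side, hence 9, and the tail threshold s/4 with s = t
  r^(1/\<gamma>) makes this 9/4. The gap 7/8 \<delta> contributes 2 * 8/7, and 9/4 * 16/7 = 36/7 is
  below 4 sqrt 2. The factor 9^(2r) counts pairs of net points. Since the singular vectors of A + E
  may be chosen freely, the event quantifies over uncountably many pairs. \<open>measure\<close> is
  0 on nonmeasurable sets, so a lower bound requires this very event to be measurable; containing a
  large measurable event would not suffice.\<close>

lemma self_adjoint_eigenvector_exists:
  fixes f :: "'a::euclidean_space \<Rightarrow> 'a"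
  assumes f: "linear f" and adj: "\<And>x y. f x \<bullet> y = x \<bullet> f y"
    and V: "subspace V" "V \<noteq> {0}" "f ` V \<subseteq> V"
  obtains v \<mu> where "v \<in> V" "norm v = 1" "f v = \<mu> *\<^sub>R v"
proof -
  let ?K = "sphere 0 1 \<inter> V"
  obtain z where z: "z \<in> V" "z \<noteq> 0" using V subspace_0 by blast
  have "(1 / norm z) *\<^sub>R z \<in> ?K" using z V by (simp add: subspace_scale)
  then have ne: "?K \<noteq> {}" by blast
  have "compact ?K" using V by (intro compact_Int_closed) (auto intro: closed_subspace)
  moreover have "continuous_on ?K (\<lambda>x. x \<bullet> f x)"
    using f by (intro continuous_intros linear_continuous_on linear_linear[THEN iffD2])
  ultimately obtain v where v: "v \<in> ?K" and vmax: "\<And>x. x \<in> ?K \<Longrightarrow> x \<bullet> f x \<le> v \<bullet> f v"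
    using ne continuous_attains_sup by metis
  define \<mu> where "\<mu> = v \<bullet> f v"
  have bound: "x \<bullet> f x \<le> \<mu> * (x \<bullet> x)" if "x \<in> V" for x
  proof (cases "x = 0")
    case False
    let ?y = "(1 / norm x) *\<^sub>R x"
    have "?y \<in> ?K" using False that V by (simp add: subspace_scale)
    from vmax[OF this] have "(x \<bullet> f x) / (norm x)\<^sup>2 \<le> \<mu>"
      by (simp add: linear_scale[OF f] \<mu>_def power2_eq_square)
    then show ?thesis using False by (simp add: power2_norm_eq_inner divide_simps mult.commute)
  qed (simp add: linear_0[OF f])
  define w where "w = f v - \<mu> *\<^sub>R v"
  have wV: "w \<in> V" using V v unfolding w_def by (auto intro!: subspace_diff subspace_scale)
  define c where "c = \<mu> * (w \<bullet> w) - w \<bullet> f w"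
  have c0: "c \<ge> 0" using bound[OF wV] by (simp add: c_def)
  have vv: "v \<bullet> v = 1" using v by (simp add: norm_eq_1)
  \<comment> \<open>First variation of the Rayleigh quotient at its maximiser \<open>v\<close>, in
    the direction of the residual \<open>w\<close>: after cancellation the linear term is
    \<open>2 * s * (w \<bullet> w)\<close>, which a quadratic term cannot dominate for small
    positive \<open>s\<close> unless \<open>w = 0\<close>.\<close>
  have quad: "2 * s * (w \<bullet> w) \<le> s\<^sup>2 * c" for s
  proof -
    have "v + s *\<^sub>R w \<in> V" using V v wV by (auto intro!: subspace_add subspace_scale)
    from bound[OF this]
    have "\<mu> + 2 * s * (w \<bullet> f v) + s\<^sup>2 * (w \<bullet> f w) \<le> \<mu> * (1 + 2 * s * (w \<bullet> v) + s\<^sup>2 * (w \<bullet> w))"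
      using adj[of v w] vv \<mu>_def
      by (simp add: linear_add[OF f] linear_scale[OF f] inner_add_left inner_add_right
          inner_commute[of "f v" w] inner_commute[of v w] power2_eq_square algebra_simps)
    moreover have "w \<bullet> f v = w \<bullet> w + \<mu> * (w \<bullet> v)" unfolding w_def by (simp add: algebra_simps inner_commute)
    ultimately show ?thesis by (simp add: c_def algebra_simps)
  qed
  have "w = 0"
  proof (rule ccontr)
    assume "w \<noteq> 0"
    then have ww: "w \<bullet> w > 0" by simp
    \<comment> \<open>Any small positive \<open>s\<close> would do; \<open>c + 1\<close> keeps the
      denominator positive when \<open>c = 0\<close>.\<close>
    define s where "s = (w \<bullet> w) / (c + 1)"
    have s: "s > 0" using ww c0 by (simp add: s_def)
    have "2 * (w \<bullet> w) \<le> s * c" using quad[of s] s by (simp add: power2_eq_square)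
    also have "\<dots> \<le> w \<bullet> w" using c0 ww by (simp add: s_def field_simps)
    finally show False using ww by simp
  qed
  then show ?thesis using that[of v \<mu>] v by (auto simp: w_def)
qed

text \<open>Split off one unit eigenvector \<open>v\<close>; by self-adjointness its orthogonal
  complement inside \<open>V\<close> is again invariant. Working with invariant subspaces instead of
  the whole space lets the induction on the dimension descend.\<close>

lemma self_adjoint_eigenbasis:
  fixes f :: "'a::euclidean_space \<Rightarrow> 'a"
  assumes f: "linear f" and adj: "\<And>x y. f x \<bullet> y = x \<bullet> f y"
    and "subspace V" "f ` V \<subseteq> V"
  shows "\<exists>B. finite B \<and> B \<subseteq> V \<and> pairwise orthogonal B \<and>
    (\<forall>b\<in>B. norm b = 1 \<and> (\<exists>\<mu>. f b = \<mu> *\<^sub>R b)) \<and> span B = V"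
  using assms(3,4)
proof (induction "dim V" arbitrary: V rule: less_induct)
  case less
  show ?case
  proof (cases "V = {0}")
    case True
    then show ?thesis by (intro exI[of _ "{}"]) simp
  next
    case False
    obtain v \<mu> where v: "v \<in> V" "norm v = 1" "f v = \<mu> *\<^sub>R v"
      using self_adjoint_eigenvector_exists[OF f adj less.prems(1) False less.prems(2)] by blast
    define W where "W = {x \<in> V. x \<bullet> v = 0}"
    have W: "subspace W" using less.prems(1) unfolding W_def subspace_def by (auto simp: inner_add_left)
    have fW: "f ` W \<subseteq> W" using less.prems(2) adj v unfolding W_def by auto
    have "v \<notin> W" using v unfolding W_def by auto
    then have "W \<subset> V" using v(1) unfolding W_def by blast
    then have "dim W < dim V" using W less.prems(1) by (metis dim_psubset span_eq_iff)
    from less.hyps[OF this W fW] obtain B where B: "finite B" "B \<subseteq> W" "pairwise orthogonal B"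
      "\<forall>b\<in>B. norm b = 1 \<and> (\<exists>\<mu>. f b = \<mu> *\<^sub>R b)" "span B = W" by blast
    have "span (insert v B) = V"
    proof
      show "span (insert v B) \<subseteq> V"
        using B v less.prems(1) \<open>W \<subset> V\<close> by (intro span_minimal) auto
      show "V \<subseteq> span (insert v B)"
      proof
        fix x assume "x \<in> V"
        then have "x - (x \<bullet> v) *\<^sub>R v \<in> W"
          using v less.prems(1) by (auto simp: W_def inner_diff_left norm_eq_1 subspace_diff subspace_scale)
        then show "x \<in> span (insert v B)" using B(5) by (auto simp: span_insert)
      qed
    qed
    moreover have "pairwise orthogonal (insert v B)"
      using B(2,3) unfolding pairwise_insert W_def orthogonal_def by (auto simp: inner_commute)
    ultimately show ?thesis
      using B v \<open>W \<subset> V\<close> by (intro exI[of _ "insert v B"]) auto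
  qed
qed

lemma orthonormal_norm_square:
  assumes "finite B" "pairwise orthogonal B" "\<And>b. b \<in> B \<Longrightarrow> norm b = 1"
  shows "(norm (\<Sum>b\<in>B. c b *\<^sub>R b))\<^sup>2 = (\<Sum>b\<in>B. (c b)\<^sup>2)"
proof -
  have "(norm (\<Sum>b\<in>B. c b *\<^sub>R b))\<^sup>2 = (\<Sum>b\<in>B. (norm (c b *\<^sub>R b))\<^sup>2)"
    using assms(1,2) by (intro norm_sum_Pythagorean) (auto simp: pairwise_def orthogonal_def)
  also have "\<dots> = (\<Sum>b\<in>B. (c b)\<^sup>2)" using assms(3) by (intro sum.cong) auto
  finally show ?thesis .
qed

section \<open>Singular values and the Gram matrix\<close>

lemma inner_transpose_matrix_vector:
  fixes A :: "real^'n^'m"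
  shows "(transpose A *v y) \<bullet> x = y \<bullet> (A *v x)"
  by (simp add: dot_lmul_matrix)

lemma sum_singleton_mset_eq_image_mset:
  "finite B \<Longrightarrow> (\<Sum>b\<in>B. {#f b#}) = image_mset f (mset_set B)"
  by (induction B rule: finite_induct) auto

text \<open>Bridges two ways of counting: \<open>singular_value_mset\<close> runs over eigenvalues
  with multiplicity, whereas an eigenbasis lists one entry per basis vector.\<close>

lemma image_mset_mset_set_by_fibres:
  assumes "finite B"
  shows "image_mset (\<lambda>b. f (g b)) (mset_set B)
       = (\<Sum>y\<in>g ` B. replicate_mset (card {b \<in> B. g b = y}) (f y))"
proof -
  have "image_mset (\<lambda>b. f (g b)) (mset_set B) = (\<Sum>y\<in>g ` B. \<Sum>b\<in>{b \<in> B. g b = y}. {#f (g b)#})"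
    using assms by (subst sum.image_gen[symmetric]) (simp_all add: sum_singleton_mset_eq_image_mset)
  also have "\<dots> = (\<Sum>y\<in>g ` B. replicate_mset (card {b \<in> B. g b = y}) (f y))"
  proof (rule sum.cong[OF refl])
    fix y
    have "(\<Sum>b\<in>{b \<in> B. g b = y}. {#f (g b)#}) = (\<Sum>b\<in>{b \<in> B. g b = y}. {#f y#})"
      by (rule sum.cong) auto
    also have "\<dots> = image_mset (\<lambda>_. f y) (mset_set {b \<in> B. g b = y})"
      using assms by (subst sum_singleton_mset_eq_image_mset) auto
    also have "\<dots> = replicate_mset (card {b \<in> B. g b = y}) (f y)"
      by (simp add: image_mset_const_eq)
    finally show "(\<Sum>b\<in>{b \<in> B. g b = y}. {#f (g b)#}) = replicate_mset (card {b \<in> B. g b = y}) (f y)" .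
  qed
  finally show ?thesis .
qed

text \<open>\<open>B\<close> consists of right singular vectors and \<open>\<nu>\<close> gives the
  squared singular values. Keeping \<open>\<nu>\<close> as a function on the basis lets a repeated
  eigenvalue occur once for each basis vector.\<close>

definition gram_eigenbasis :: "real^'n^'m \<Rightarrow> (real^'n) set \<Rightarrow> (real^'n \<Rightarrow> real) \<Rightarrow> bool" where
  "gram_eigenbasis A B \<nu> \<longleftrightarrow> finite B \<and> pairwise orthogonal B \<and> (\<forall>b\<in>B. norm b = 1) \<and> span B = UNIV \<and>
     (\<forall>b\<in>B. (transpose A ** A) *v b = \<nu> b *\<^sub>R b)"

lemma gram_eigenbasis_exists:
  fixes A :: "real^'n^'m"
  obtains B \<nu> where "gram_eigenbasis A B \<nu>"
proof -
  let ?G = "transpose A ** A"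
  have "(?G *v x) \<bullet> y = x \<bullet> (?G *v y)" for x y
    using inner_transpose_matrix_vector[of ?G x y] by (simp add: matrix_transpose_mul)
  from self_adjoint_eigenbasis[OF matrix_vector_mul_linear this subspace_UNIV]
  obtain B where B: "finite B" "pairwise orthogonal B" "span B = UNIV"
      "\<forall>b\<in>B. norm b = 1 \<and> (\<exists>\<mu>. ?G *v b = \<mu> *\<^sub>R b)" by auto
  then have "\<forall>b\<in>B. ?G *v b = (SOME \<mu>. ?G *v b = \<mu> *\<^sub>R b) *\<^sub>R b" by (metis (mono_tags, lifting) someI_ex)
  then show ?thesis using B that[of B "\<lambda>b. SOME \<mu>. ?G *v b = \<mu> *\<^sub>R b"] by (auto simp: gram_eigenbasis_def)
qed

lemma norm_matrix_vector_gram_eigenbasis: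
  fixes A :: "real^'n^'m"
  assumes "gram_eigenbasis A B \<nu>"
  shows "(norm (A *v x))\<^sup>2 = (\<Sum>b\<in>B. \<nu> b * (x \<bullet> b)\<^sup>2)"
proof -
  note B = assms[unfolded gram_eigenbasis_def]
  have x: "x = (\<Sum>b\<in>B. (x \<bullet> b) *\<^sub>R b)" using B orthonormal_basis_expand[of B x] by auto
  have "(norm (A *v x))\<^sup>2 = x \<bullet> ((transpose A ** A) *v x)"
    using inner_transpose_matrix_vector[of A "A *v x" x]
    by (simp add: power2_norm_eq_inner matrix_vector_mul_assoc[symmetric] inner_commute)
  also have "(transpose A ** A) *v x = (\<Sum>b\<in>B. (x \<bullet> b) *\<^sub>R (\<nu> b *\<^sub>R b))"
    using B by (subst x) (simp add: linear_sum[OF matrix_vector_mul_linear] matrix_vector_mult_scaleR)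
  also have "x \<bullet> \<dots> = (\<Sum>b\<in>B. \<nu> b * (x \<bullet> b)\<^sup>2)"
    by (simp add: inner_sum_right power2_eq_square algebra_simps)
  finally show ?thesis .
qed

lemma norm_matrix_vector_gram_basis_vector:
  fixes A :: "real^'n^'m"
  assumes B: "gram_eigenbasis A B \<nu>" and "b \<in> B"
  shows "(norm (A *v b))\<^sup>2 = \<nu> b"
proof -
  have "(norm (A *v b))\<^sup>2 = b \<bullet> ((transpose A ** A) *v b)"
    using inner_transpose_matrix_vector[of A "A *v b" b]
    by (simp add: power2_norm_eq_inner matrix_vector_mul_assoc[symmetric] inner_commute)
  also have "\<dots> = \<nu> b" using assms by (auto simp: gram_eigenbasis_def norm_eq_1)
  finally show ?thesis .
qed

lemma gram_eigenvalue_nonneg: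
  fixes A :: "real^'n^'m"
  assumes "gram_eigenbasis A B \<nu>" "b \<in> B"
  shows "\<nu> b \<ge> 0"
  using norm_matrix_vector_gram_basis_vector[OF assms] by (metis zero_le_power2)

text \<open>Since \<open>B\<close> spans, the eigenvector equation can be tested against each
  \<open>b\<close>, where self-adjointness reduces it to
  \<open>\<nu> b * (x \<bullet> b) = \<mu> * (x \<bullet> b)\<close>.\<close>

lemma eigenspace_gram_iff:
  fixes A :: "real^'n^'m"
  assumes B: "gram_eigenbasis A B \<nu>"
  shows "x \<in> eigenspace (transpose A ** A) \<mu> \<longleftrightarrow> (\<forall>b\<in>B. x \<bullet> b \<noteq> 0 \<longrightarrow> \<nu> b = \<mu>)"
proof -
  let ?G = "transpose A ** A"
  have adj: "(?G *v x) \<bullet> b = x \<bullet> (?G *v b)" for b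
    using inner_transpose_matrix_vector[of ?G x b] by (simp add: matrix_transpose_mul)
  have "x \<in> eigenspace ?G \<mu> \<longleftrightarrow> (\<forall>b\<in>B. b \<bullet> (?G *v x) = b \<bullet> (\<mu> *\<^sub>R x))"
    using vector_eq_dot_span[of "?G *v x" B "\<mu> *\<^sub>R x"] B
    by (auto simp: eigenspace_def gram_eigenbasis_def)
  also have "\<dots> \<longleftrightarrow> (\<forall>b\<in>B. \<nu> b * (x \<bullet> b) = \<mu> * (x \<bullet> b))"
    using B adj by (intro ball_cong refl) (auto simp: gram_eigenbasis_def inner_commute)
  finally show ?thesis by auto
qed

lemma eigenspace_gram_eq_span:
  fixes A :: "real^'n^'m"
  assumes B: "gram_eigenbasis A B \<nu>"
  shows "eigenspace (transpose A ** A) \<mu> = span {b \<in> B. \<nu> b = \<mu>}"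
proof
  show "eigenspace (transpose A ** A) \<mu> \<subseteq> span {b \<in> B. \<nu> b = \<mu>}"
  proof
    fix x assume "x \<in> eigenspace (transpose A ** A) \<mu>"
    then have x: "\<forall>b\<in>B. x \<bullet> b \<noteq> 0 \<longrightarrow> \<nu> b = \<mu>" using eigenspace_gram_iff[OF B] by blast
    have "x = (\<Sum>b\<in>B. (x \<bullet> b) *\<^sub>R b)"
      using B orthonormal_basis_expand[of B x] by (auto simp: gram_eigenbasis_def)
    moreover have "(x \<bullet> b) *\<^sub>R b \<in> span {b \<in> B. \<nu> b = \<mu>}" if "b \<in> B" for b
      using x that by (cases "x \<bullet> b = 0") (auto intro: span_base span_scale span_zero)
    ultimately show "x \<in> span {b \<in> B. \<nu> b = \<mu>}" by (metis (no_types, lifting) span_sum)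
  qed
  show "span {b \<in> B. \<nu> b = \<mu>} \<subseteq> eigenspace (transpose A ** A) \<mu>"
  proof (rule span_minimal)
    show "{b \<in> B. \<nu> b = \<mu>} \<subseteq> eigenspace (transpose A ** A) \<mu>"
      using B by (auto simp: gram_eigenbasis_def eigenspace_def)
    show "subspace (eigenspace (transpose A ** A) \<mu>)"
      by (auto simp: subspace_def eigenspace_def matrix_vector_right_distrib matrix_vector_mult_scaleR scaleR_add_right)
  qed
qed

lemma gram_eigenbasis_independent:
  assumes "gram_eigenbasis A B \<nu>"
  shows "independent B"
  using assms by (intro pairwise_orthogonal_independent) (auto simp: gram_eigenbasis_def)

lemma eigenvalues_gram:
  fixes A :: "real^'n^'m"
  assumes B: "gram_eigenbasis A B \<nu>"
  shows "eigenvalues (transpose A ** A) = \<nu> ` B"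
proof (intro set_eqI iffI)
  fix \<mu> assume "\<mu> \<in> eigenvalues (transpose A ** A)"
  then obtain x where x: "x \<noteq> 0" "x \<in> span {b \<in> B. \<nu> b = \<mu>}"
    by (auto simp: eigenvalues_def eigenspace_gram_eq_span[OF B])
  then have "{b \<in> B. \<nu> b = \<mu>} \<noteq> {}" by (metis empty_iff insert_iff span_empty)
  then show "\<mu> \<in> \<nu> ` B" by blast
next
  fix \<mu> assume "\<mu> \<in> \<nu> ` B"
  then obtain b where "b \<in> B" "\<nu> b = \<mu>" by blast
  then show "\<mu> \<in> eigenvalues (transpose A ** A)"
    using B unfolding eigenvalues_def eigenspace_gram_eq_span[OF B]
    by (intro CollectI exI[of _ b]) (auto simp: gram_eigenbasis_def intro: span_base)
qed

lemma singular_value_mset_eq: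
  fixes A :: "real^'n^'m"
  assumes B: "gram_eigenbasis A B \<nu>"
  shows "singular_value_mset A = image_mset (\<lambda>b. sqrt (\<nu> b)) (mset_set B)"
proof -
  have "dim (eigenspace (transpose A ** A) \<mu>) = card {b \<in> B. \<nu> b = \<mu>}" for \<mu>
    unfolding eigenspace_gram_eq_span[OF B] dim_span
    by (rule dim_eq_card_independent, rule independent_mono[OF gram_eigenbasis_independent[OF B]]) auto
  then show ?thesis
    using B image_mset_mset_set_by_fibres[of B sqrt \<nu>]
    by (simp add: singular_value_mset_def eigenvalues_gram[OF B] gram_eigenbasis_def)
qed

lemma card_gram_eigenbasis:
  fixes A :: "real^'n^'m"
  assumes B: "gram_eigenbasis A B \<nu>"
  shows "card B = CARD('n)"
proof -
  have "card B = dim (span B)"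
    using dim_eq_card_independent[OF gram_eigenbasis_independent[OF B]] by simp
  then show ?thesis using B by (simp add: gram_eigenbasis_def del: dim_span)
qed

text \<open>\<open>L\<close> is the list indexed by \<^const>\<open>singular_value\<close>, without the truncation to
  \<open>min CARD('m) CARD('n)\<close> entries.\<close>

lemma singular_value_list:
  fixes A :: "real^'n^'m"
  assumes B: "gram_eigenbasis A B \<nu>"
  obtains L where "mset L = image_mset (\<lambda>b. sqrt (\<nu> b)) (mset_set B)" "sorted_wrt (\<ge>) L"
    "length L = CARD('n)" "singular_value A 1 = hd L"
    "singular_value A 2 = (if 2 \<le> CARD('m) \<and> 2 \<le> CARD('n) then hd (tl L) else 0)"
proof -
  define L where "L = rev (sorted_list_of_multiset (singular_value_mset A))"
  have 1: "mset L = image_mset (\<lambda>b. sqrt (\<nu> b)) (mset_set B)"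
    by (simp add: L_def singular_value_mset_eq[OF B])
  have "sorted_wrt (\<le>) (rev L)" by (simp add: L_def)
  then have 2: "sorted_wrt (\<ge>) L" unfolding sorted_wrt_rev .
  have 3: "length L = CARD('n)"
    using card_gram_eigenbasis[OF B] arg_cong[OF 1, of size] by simp
  have "CARD('n) > 0" "CARD('m) > 0" by simp_all
  then have 4: "singular_value A 1 = hd L"
    using 3 by (subst hd_conv_nth) (auto simp: singular_value_def L_def[symmetric])
  have 5: "singular_value A 2 = (if 2 \<le> CARD('m) \<and> 2 \<le> CARD('n) then hd (tl L) else 0)"
    using 3 by (cases L; cases "tl L") (auto simp: singular_value_def L_def[symmetric])
  show thesis using that[OF 1 2 3 4 5] .
qed

text \<open>Removing a single vector \<open>b0\<close>, and not the whole top eigenspace, matches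
  removing the head of the sorted list, so a repeated top value reappears as the second one. The
  last clause asks for both dimensions to be at least 2 because otherwise
  \<open>singular_value A 2\<close> is the default 0 and not a list entry.\<close>

lemma gram_eigenbasis_top:
  fixes A :: "real^'n^'m"
  assumes B: "gram_eigenbasis A B \<nu>"
  obtains b0 where "b0 \<in> B" "singular_value A 1 = sqrt (\<nu> b0)"
    "\<And>b. b \<in> B \<Longrightarrow> sqrt (\<nu> b) \<le> sqrt (\<nu> b0)"
    "0 \<le> singular_value A 2" "singular_value A 2 \<le> singular_value A 1"
    "\<And>b. 2 \<le> CARD('m) \<Longrightarrow> 2 \<le> CARD('n) \<Longrightarrow> b \<in> B - {b0} \<Longrightarrow> sqrt (\<nu> b) \<le> singular_value A 2"
proof -
  have fin: "finite B" using B by (simp add: gram_eigenbasis_def)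
  obtain L where L: "mset L = image_mset (\<lambda>b. sqrt (\<nu> b)) (mset_set B)" "sorted_wrt (\<ge>) L"
    "length L = CARD('n)" "singular_value A 1 = hd L"
    "singular_value A 2 = (if 2 \<le> CARD('m) \<and> 2 \<le> CARD('n) then hd (tl L) else 0)"
    using singular_value_list[OF B] .
  have set_L: "set L = (\<lambda>b. sqrt (\<nu> b)) ` B"
    using arg_cong[OF L(1), of set_mset] fin by simp
  have "L \<noteq> []" using L(3) by auto
  then obtain x L' where xL: "L = x # L'" by (cases L) auto
  then obtain b0 where b0: "b0 \<in> B" "x = sqrt (\<nu> b0)" using set_L by auto
  have "mset L' = image_mset (\<lambda>b. sqrt (\<nu> b)) (mset_set (B - {b0}))"
    using L(1) b0 fin by (simp add: xL mset_set.remove[OF fin b0(1)])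
  then have set_L': "set L' = (\<lambda>b. sqrt (\<nu> b)) ` (B - {b0})"
    using fin by (metis finite_Diff finite_set_mset_mset_set set_image_mset set_mset_mset)
  have le: "sqrt (\<nu> b) \<le> sqrt (\<nu> b0)" if "b \<in> B" for b
    using L(2) set_L' that b0 by (cases "b = b0") (auto simp: xL)
  have nonneg: "y \<ge> 0" if "y \<in> set L" for y
    using that gram_eigenvalue_nonneg[OF B] by (auto simp: set_L)
  have second: "sqrt (\<nu> b) \<le> singular_value A 2"
    if "2 \<le> CARD('m)" "2 \<le> CARD('n)" "b \<in> B - {b0}" for b
  proof -
    from that(3) have b: "sqrt (\<nu> b) \<in> set L'" by (auto simp: set_L')
    then obtain y L'' where "L' = y # L''" by (cases L') auto
    with L(2,5) b that show ?thesis by (auto simp: xL)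
  qed
  have "hd (tl L) \<in> set L'" if "2 \<le> CARD('n)"
    using L(3) that by (cases L') (auto simp: xL)
  then have "0 \<le> singular_value A 2" "singular_value A 2 \<le> singular_value A 1"
    using L(2,4,5) nonneg by (auto simp: xL)
  then show thesis using that[of b0] b0 le second L(4) by (simp add: xL)
qed

section \<open>Norm bounds by the first two singular values\<close>

lemma singular_value_2_bounds:
  fixes A :: "real^'n^'m"
  shows singular_value_2_nonneg: "0 \<le> singular_value A 2"
    and singular_value_2_le_1: "singular_value A 2 \<le> singular_value A 1"
proof -
  obtain B \<nu> where B: "gram_eigenbasis A B \<nu>" using gram_eigenbasis_exists .
  show "0 \<le> singular_value A 2" by (rule gram_eigenbasis_top[OF B])
  show "singular_value A 2 \<le> singular_value A 1" by (rule gram_eigenbasis_top[OF B])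
qed

text \<open>Parseval in the eigenbasis. Restricting the hypothesis to basis vectors that occur in
  \<open>x\<close> is what yields the smaller bound by the second singular value on the complement
  of the top vector.\<close>

lemma norm_matrix_vector_le_on_eigenvectors:
  fixes A :: "real^'n^'m"
  assumes B: "gram_eigenbasis A B \<nu>" and "s \<ge> 0"
    and le: "\<And>b. b \<in> B \<Longrightarrow> x \<bullet> b \<noteq> 0 \<Longrightarrow> sqrt (\<nu> b) \<le> s"
  shows "norm (A *v x) \<le> s * norm x"
proof -
  have x: "x = (\<Sum>b\<in>B. (x \<bullet> b) *\<^sub>R b)"
    using B orthonormal_basis_expand[of B x] by (auto simp: gram_eigenbasis_def)
  have "(norm (A *v x))\<^sup>2 = (\<Sum>b\<in>B. \<nu> b * (x \<bullet> b)\<^sup>2)"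
    by (rule norm_matrix_vector_gram_eigenbasis[OF B])
  also have "\<dots> \<le> (\<Sum>b\<in>B. s\<^sup>2 * (x \<bullet> b)\<^sup>2)"
  proof (rule sum_mono)
    fix b assume b: "b \<in> B"
    show "\<nu> b * (x \<bullet> b)\<^sup>2 \<le> s\<^sup>2 * (x \<bullet> b)\<^sup>2"
    proof (cases "x \<bullet> b = 0")
      case False
      then have "\<nu> b \<le> s\<^sup>2" using le[OF b] by (intro sqrt_le_D)
      then show ?thesis by (rule mult_right_mono) simp
    qed simp
  qed
  also have "\<dots> = s\<^sup>2 * (norm (\<Sum>b\<in>B. (x \<bullet> b) *\<^sub>R b))\<^sup>2"
    using B by (subst orthonormal_norm_square) (auto simp: gram_eigenbasis_def sum_distrib_left)
  also have "\<dots> = (s * norm x)\<^sup>2" using x by (simp add: power_mult_distrib)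
  finally show ?thesis using \<open>s \<ge> 0\<close> by (simp add: power2_le_iff_abs_le)
qed

lemma norm_matrix_vector_le_singular_value_1:
  fixes A :: "real^'n^'m"
  shows "norm (A *v x) \<le> singular_value A 1 * norm x"
proof -
  obtain B \<nu> where B: "gram_eigenbasis A B \<nu>" using gram_eigenbasis_exists .
  obtain b0 where "singular_value A 1 = sqrt (\<nu> b0)" "\<And>b. b \<in> B \<Longrightarrow> sqrt (\<nu> b) \<le> sqrt (\<nu> b0)"
    by (rule gram_eigenbasis_top[OF B]) blast
  moreover have "singular_value A 1 \<ge> 0"
    using singular_value_2_nonneg singular_value_2_le_1 by (rule order_trans)
  ultimately show ?thesis by (intro norm_matrix_vector_le_on_eigenvectors[OF B]) auto
qed

lemma orthogonal_unit_eq_0_if_dim_1: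
  fixes x u :: "real^'k"
  assumes "CARD('k) = 1" "norm u = 1" "x \<bullet> u = 0"
  shows "x = 0"
proof (rule ccontr)
  assume "x \<noteq> 0"
  with assms have "independent {x, u}"
    by (intro pairwise_orthogonal_independent) (auto simp: pairwise_def orthogonal_def inner_commute)
  moreover have "x \<noteq> u" using assms by (auto simp: norm_eq_1)
  ultimately show False using independent_bound[of "{x, u}"] assms(1) by simp
qed

text \<open>The gap makes the top eigenvalue of the Gram matrix simple, so \<open>v\<close> is a
  multiple of \<open>b0\<close> and \<open>x\<close> has no component along \<open>b0\<close>. If a
  dimension is 1, the bound is 0 by convention and \<open>A *v x\<close> must vanish
  outright.\<close>

lemma norm_matrix_vector_le_singular_value_2:
  fixes A :: "real^'n^'m"
  assumes gap: "singular_value A 2 < singular_value A 1"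
    and uv: "singular_pair A (singular_value A 1) u v" and x: "x \<bullet> v = 0"
  shows "norm (A *v x) \<le> singular_value A 2 * norm x"
proof -
  have "CARD('n) > 0" "CARD('m) > 0" by simp_all
  then consider "CARD('n) = 1" | "CARD('m) = 1" | "2 \<le> CARD('m)" "2 \<le> CARD('n)" by linarith
  then show ?thesis
  proof cases
    case 1
    then have "x = 0" using orthogonal_unit_eq_0_if_dim_1 uv x by (auto simp: singular_pair_def)
    then show ?thesis by simp
  next
    case 2
    \<comment> \<open>The codomain is the line through \<open>u\<close>, so it suffices that
      \<open>A *v x\<close> is orthogonal to \<open>u\<close>.\<close>
    have "(A *v x) \<bullet> u = (transpose A *v u) \<bullet> x"
      by (metis inner_transpose_matrix_vector inner_commute)
    also have "\<dots> = 0" using uv x by (simp add: singular_pair_def inner_commute)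
    finally have "A *v x = 0" using orthogonal_unit_eq_0_if_dim_1[OF 2] uv by (auto simp: singular_pair_def)
    then show ?thesis using singular_value_2_nonneg[of A] by simp
  next
    case 3
    obtain B \<nu> where B: "gram_eigenbasis A B \<nu>" using gram_eigenbasis_exists .
    obtain b0 where b0: "b0 \<in> B" "singular_value A 1 = sqrt (\<nu> b0)"
      "\<And>b. b \<in> B - {b0} \<Longrightarrow> sqrt (\<nu> b) \<le> singular_value A 2"
      by (rule gram_eigenbasis_top[OF B]) (use 3 in simp)
    have "(transpose A ** A) *v v = (singular_value A 1)\<^sup>2 *\<^sub>R v"
      using uv by (simp add: singular_pair_def matrix_vector_mul_assoc[symmetric]
          matrix_vector_mult_scaleR power2_eq_square del: transpose_matrix_vector)
    moreover have "(singular_value A 1)\<^sup>2 = \<nu> b0"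
      using b0 gram_eigenvalue_nonneg[OF B b0(1)] by simp
    ultimately have "v \<in> span {b \<in> B. \<nu> b = \<nu> b0}"
      using eigenspace_gram_eq_span[OF B] by (auto simp: eigenspace_def)
    \<comment> \<open>A second basis vector with this eigenvalue would force
      \<open>singular_value A 1 \<le> singular_value A 2\<close>.\<close>
    also have "{b \<in> B. \<nu> b = \<nu> b0} = {b0}" using b0 gap by force
    finally obtain k where "v = k *\<^sub>R b0" by (auto simp: span_singleton)
    moreover have "v \<noteq> 0" using uv by (auto simp: singular_pair_def)
    ultimately have "x \<bullet> b0 = 0" using x by auto
    then show ?thesis
      using b0(3) by (intro norm_matrix_vector_le_on_eigenvectors[OF B singular_value_2_nonneg]) blast
  qed
qed

section \<open>Nets of unit balls of subspaces\<close>

lemma sum_half_power_abs_eq: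
  "(\<Sum>j\<in>{-int M..int M}. (1/2::real) ^ nat \<bar>j\<bar>) = 3 - 2 * (1/2) ^ M"
proof (induction M)
  case (Suc M)
  have "{-int (Suc M)..int (Suc M)} = insert (-int (Suc M)) (insert (int (Suc M)) {-int M..int M})" by auto
  then have "(\<Sum>j\<in>{-int (Suc M)..int (Suc M)}. (1/2::real) ^ nat \<bar>j\<bar>) =
     (1/2) ^ Suc M + ((1/2) ^ Suc M + (\<Sum>j\<in>{-int M..int M}. (1/2::real) ^ nat \<bar>j\<bar>))"
    by (simp add: nat_add_distrib)
  then show ?case using Suc by simp
qed simp

text \<open>Weighting \<open>k\<close> by the product of the \<open>2\<^bsup>-\<bar>k b\<bar>\<^esup>\<close> gives the bound
  \<open>(2\<^bsup>3/2\<^esup> \<cdot> 3)\<^bsup>card B\<^esup>\<close>.\<close>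

lemma card_integer_vectors_l1_ball_le:
  assumes "finite B"
  shows "card {k \<in> B \<rightarrow>\<^sub>E {-int M..int M}. 2 * (\<Sum>b\<in>B. nat \<bar>k b\<bar>) \<le> 3 * card B} \<le> 9 ^ card B"
proof -
  let ?P = "B \<rightarrow>\<^sub>E {-int M..int M}"
  let ?K = "{k \<in> ?P. 2 * (\<Sum>b\<in>B. nat \<bar>k b\<bar>) \<le> 3 * card B}"
  let ?w = "\<lambda>k. \<Prod>b\<in>B. (1/2::real) ^ nat \<bar>k b\<bar>"
  have finP: "finite ?P" using assms by (intro finite_PiE) auto
  \<comment> \<open>On \<open>?K\<close> the exponent sum is at most 3/2 times
    \<open>card B\<close>, so each weight is at least \<open>sqrt 8\<close> to the power
    \<open>- card B\<close>.\<close>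
  have weight: "1 \<le> sqrt 8 ^ card B * ?w k" if "k \<in> ?K" for k
  proof -
    let ?m = "\<Sum>b\<in>B. nat \<bar>k b\<bar>"
    have "(2 ^ ?m)\<^sup>2 = (2::real) ^ (2 * ?m)" by (simp add: power_mult[symmetric] mult.commute)
    also have "\<dots> \<le> 2 ^ (3 * card B)" using that by (intro power_increasing) auto
    also have "\<dots> = (sqrt 8 ^ card B)\<^sup>2"
      by (simp add: power_mult power_mult_distrib[symmetric] power_even_eq[symmetric] power2_eq_square)
    finally have "2 ^ ?m \<le> sqrt 8 ^ card B" by (rule power2_le_imp_le) simp
    moreover have w: "?w k = 1 / 2 ^ ?m" by (simp add: power_sum power_one_over prod_dividef)
    ultimately show ?thesis unfolding w by (simp add: divide_simps)
  qed
  have "real (card ?K) = (\<Sum>k\<in>?K. 1)" by simp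
  also have "\<dots> \<le> (\<Sum>k\<in>?K. sqrt 8 ^ card B * ?w k)" using weight by (rule sum_mono)
  \<comment> \<open>Dropping the constraint leaves a full box, over which the sum of products
    factorises into geometric sums, each below 3.\<close>
  also have "\<dots> \<le> (\<Sum>k\<in>?P. sqrt 8 ^ card B * ?w k)"
    using finP by (intro sum_mono2) (auto intro!: mult_nonneg_nonneg prod_nonneg)
  also have "\<dots> = sqrt 8 ^ card B * (\<Prod>b\<in>B. \<Sum>j\<in>{-int M..int M}. (1/2) ^ nat \<bar>j\<bar>)"
    using assms by (subst prod_sum_PiE) (auto simp: sum_distrib_left)
  also have "\<dots> \<le> sqrt 8 ^ card B * 3 ^ card B"
    using power_le_one[of "1/2::real" M]
    by (intro mult_left_mono) (auto simp: sum_half_power_abs_eq intro!: power_mono)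
  also have "\<dots> = (sqrt 8 * 3) ^ card B" by (simp add: power_mult_distrib)
  also have "\<dots> \<le> 9 ^ card B"
  proof (rule power_mono)
    have "sqrt 8 \<le> 3" by (rule real_le_lsqrt) auto
    then show "sqrt 8 * 3 \<le> 9" by simp
  qed simp
  finally have "real (card ?K) \<le> real (9 ^ card B)" by simp
  then show ?thesis by (simp only: of_nat_le_iff)
qed

text \<open>Rounding toward 0 admits an error of 1 where rounding to the nearest integer admits 1/2,
  but it never enlarges a coordinate. So the rounded point stays in the unit ball and its l1 norm
  stays controlled.\<close>

lemma truncate_toward_0:
  fixes y :: real
  obtains k :: int where "\<bar>real_of_int k\<bar> \<le> \<bar>y\<bar>" "\<bar>y - real_of_int k\<bar> \<le> 1"
proof (cases "y \<ge> 0")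
  case True
  then have "real_of_int \<lfloor>y\<rfloor> \<ge> 0" by simp
  with True show ?thesis by (intro that[of "\<lfloor>y\<rfloor>"]) linarith+
next
  case False
  then have "real_of_int \<lceil>y\<rceil> \<le> 0" by simp
  with False show ?thesis by (intro that[of "\<lceil>y\<rceil>"]) linarith+
qed

text \<open>The net consists of the points of the grid with mesh \<open>2/(3\<surd>(dim S))\<close>, in orthonormal
  coordinates of \<open>S\<close>, that arise by rounding toward the origin.\<close>

lemma unit_ball_net_exists:
  fixes S :: "'a::euclidean_space set"
  assumes S: "subspace S"
  obtains N where "finite N" "N \<subseteq> S" "N \<subseteq> cball 0 1" "card N \<le> 9 ^ dim S"
    "\<And>x. x \<in> S \<Longrightarrow> norm x \<le> 1 \<Longrightarrow> \<exists>y\<in>N. norm (x - y) \<le> 2/3"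
proof -
  obtain B where B: "B \<subseteq> S" "pairwise orthogonal B" "\<And>b. b \<in> B \<Longrightarrow> norm b = 1"
    "independent B" "card B = dim S" "span B = S"
    using orthonormal_basis_subspace[OF S] by metis
  have fin: "finite B" using B(4) by (rule independent_imp_finite)
  let ?r = "card B"
  show thesis
  proof (cases "?r = 0")
    case True
    then have "S = {0}" using fin B(6) by simp
    then show thesis using that[of "{0}"] by simp
  next
    case False
    \<comment> \<open>An error of at most \<open>h\<close> in each of \<open>?r\<close> orthonormal
      coordinates has norm at most \<open>sqrt ?r * h = 2/3\<close>.\<close>
    define h where "h = 2 / (3 * sqrt ?r)"
    have h: "h > 0" using False by (simp add: h_def)
    have hr: "real ?r * h\<^sup>2 = (2/3)\<^sup>2" using False by (simp add: h_def power_divide power_mult_distrib)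
    \<comment> \<open>By Cauchy-Schwarz the l1 norm of a point of the unit ball is at most
      \<open>sqrt ?r\<close>, that is \<open>3/2 * ?r\<close> in units of \<open>h\<close>. This
      also bounds every single coordinate, so the box, which makes \<open>K\<close> finite, excludes
      no rounded point.\<close>
    define K where "K = {k \<in> B \<rightarrow>\<^sub>E {-int (2 * ?r)..int (2 * ?r)}. 2 * (\<Sum>b\<in>B. nat \<bar>k b\<bar>) \<le> 3 * ?r}"
    define g where "g k = (\<Sum>b\<in>B. (h * real_of_int (k b)) *\<^sub>R b)" for k
    have "finite (B \<rightarrow>\<^sub>E {-int (2 * ?r)..int (2 * ?r)})" using fin by (intro finite_PiE) auto
    then have finK: "finite K" unfolding K_def by simp
    have cardK: "card K \<le> 9 ^ ?r" unfolding K_def by (rule card_integer_vectors_l1_ball_le[OF fin])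
    \<comment> \<open>Some vectors in \<open>K\<close> give grid points outside the unit ball; the
      intersection discards them.\<close>
    define N where "N = g ` K \<inter> cball 0 1"
    have "card N \<le> card K" unfolding N_def using finK
      by (meson card_image_le card_mono finite_imageI inf_le1 order_trans)
    then have "card N \<le> 9 ^ dim S" using cardK B(5) by simp
    moreover have "N \<subseteq> S"
      unfolding N_def g_def using S B(1) by (auto intro!: subspace_sum subspace_scale)
    moreover have "\<exists>y\<in>N. norm (x - y) \<le> 2/3" if x: "x \<in> S" "norm x \<le> 1" for x
    proof -
      have ex: "\<exists>j::int. \<bar>real_of_int j\<bar> \<le> \<bar>(x \<bullet> b) / h\<bar> \<and> \<bar>(x \<bullet> b) / h - real_of_int j\<bar> \<le> 1" for b
        using truncate_toward_0 by metis
      define k where "k = restrict (\<lambda>b. SOME j::int.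
          \<bar>real_of_int j\<bar> \<le> \<bar>(x \<bullet> b) / h\<bar> \<and> \<bar>(x \<bullet> b) / h - real_of_int j\<bar> \<le> 1) B"
      have k: "\<bar>real_of_int (k b)\<bar> \<le> \<bar>(x \<bullet> b) / h\<bar>" "\<bar>(x \<bullet> b) / h - real_of_int (k b)\<bar> \<le> 1" if "b \<in> B" for b
        using someI_ex[OF ex[of b]] that by (auto simp: k_def)
      have xe: "x = (\<Sum>b\<in>B. (x \<bullet> b) *\<^sub>R b)"
        using B fin x orthonormal_basis_expand[of B x] by auto
      have nx: "(norm x)\<^sup>2 = (\<Sum>b\<in>B. (x \<bullet> b)\<^sup>2)"
        using orthonormal_norm_square[OF fin B(2,3), of "\<lambda>b. x \<bullet> b"] xe by simp
      have nx1: "(norm x)\<^sup>2 \<le> 1" using x(2) by (simp add: power_le_one)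
      have "(norm (g k))\<^sup>2 = (\<Sum>b\<in>B. (h * real_of_int (k b))\<^sup>2)"
        unfolding g_def by (rule orthonormal_norm_square[OF fin B(2,3)])
      also have "\<dots> \<le> (\<Sum>b\<in>B. (x \<bullet> b)\<^sup>2)"
      proof (rule sum_mono)
        fix b assume "b \<in> B"
        from k(1)[OF this] have "\<bar>h * real_of_int (k b)\<bar> \<le> \<bar>x \<bullet> b\<bar>"
          using h by (simp add: abs_mult field_simps)
        then show "(h * real_of_int (k b))\<^sup>2 \<le> (x \<bullet> b)\<^sup>2" by (simp only: abs_le_square_iff)
      qed
      finally have "(norm (g k))\<^sup>2 \<le> 1\<^sup>2" using nx nx1 by simp
      then have gk1: "norm (g k) \<le> 1" by (rule power2_le_imp_le) simp
      have "x - g k = (\<Sum>b\<in>B. (x \<bullet> b - h * real_of_int (k b)) *\<^sub>R b)"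
        by (subst xe) (simp add: g_def sum_subtractf[symmetric] scaleR_diff_left)
      then have "(norm (x - g k))\<^sup>2 = (\<Sum>b\<in>B. (x \<bullet> b - h * real_of_int (k b))\<^sup>2)"
        using orthonormal_norm_square[OF fin B(2,3)] by simp
      also have "\<dots> \<le> (\<Sum>b\<in>B. h\<^sup>2)"
      proof (rule sum_mono)
        fix b assume "b \<in> B"
        have "\<bar>x \<bullet> b - h * real_of_int (k b)\<bar> = h * \<bar>(x \<bullet> b) / h - real_of_int (k b)\<bar>"
          using h by (simp add: abs_mult_pos' field_simps)
        also have "\<dots> \<le> \<bar>h\<bar>" using k(2)[OF \<open>b \<in> B\<close>] h by (simp add: mult_left_le)
        finally show "(x \<bullet> b - h * real_of_int (k b))\<^sup>2 \<le> h\<^sup>2" by (simp only: abs_le_square_iff)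
      qed
      also have "\<dots> = (2/3)\<^sup>2" using hr by simp
      finally have close: "norm (x - g k) \<le> 2/3" by (rule power2_le_imp_le) simp
      have "(\<Sum>b\<in>B. \<bar>x \<bullet> b\<bar>)\<^sup>2 \<le> real ?r * (\<Sum>b\<in>B. \<bar>x \<bullet> b\<bar>\<^sup>2)"
        using sum_squared_le_sum_of_squares[of "\<lambda>b. \<bar>x \<bullet> b\<bar>" B] fin by (simp add: mult.commute)
      also have "\<dots> \<le> real ?r" using nx nx1 mult_left_mono[of "(norm x)\<^sup>2" 1 "real ?r"] by simp
      also have "\<dots> = (sqrt ?r)\<^sup>2" by simp
      finally have l1: "(\<Sum>b\<in>B. \<bar>x \<bullet> b\<bar>) \<le> sqrt ?r" by (rule power2_le_imp_le) simp
      have "real (\<Sum>b\<in>B. nat \<bar>k b\<bar>) = (\<Sum>b\<in>B. \<bar>real_of_int (k b)\<bar>)" by simp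
      also have "\<dots> \<le> (\<Sum>b\<in>B. \<bar>x \<bullet> b\<bar> / h)" using k(1) h by (intro sum_mono) (simp add: abs_divide)
      also have "\<dots> = (\<Sum>b\<in>B. \<bar>x \<bullet> b\<bar>) / h" by (simp add: sum_divide_distrib)
      also have "\<dots> \<le> sqrt ?r / h" using l1 h by (simp add: divide_right_mono)
      also have "\<dots> = 3 / 2 * real ?r" by (simp add: h_def)
      finally have "2 * real (\<Sum>b\<in>B. nat \<bar>k b\<bar>) \<le> 3 * real ?r" by simp
      then have sumk: "2 * (\<Sum>b\<in>B. nat \<bar>k b\<bar>) \<le> 3 * ?r" by linarith
      have "\<bar>k b\<bar> \<le> int (2 * ?r)" if "b \<in> B" for b
        using member_le_sum[of b B "\<lambda>b. nat \<bar>k b\<bar>"] fin that sumk by linarith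
      then have "\<forall>b\<in>B. k b \<in> {-int (2 * ?r)..int (2 * ?r)}" by (simp add: abs_le_iff minus_le_iff)
      moreover have "k \<in> extensional B" by (simp add: k_def)
      ultimately have "k \<in> B \<rightarrow>\<^sub>E {-int (2 * ?r)..int (2 * ?r)}" by (simp add: PiE_iff)
      then have "k \<in> K" using sumk by (simp add: K_def)
      then show ?thesis using gk1 close by (intro bexI[of _ "g k"]) (auto simp: N_def)
    qed
    ultimately show thesis using that[of N] finK by (auto simp: N_def)
  qed
qed

text \<open>If \<open>z\<close> maximises \<open>\<bar>f\<bar>\<close> on the unit ball of
  \<open>S\<close>, a net point near \<open>z\<close> gives
  \<open>\<bar>f z\<bar> \<le> \<tau> + 2/3 * \<bar>f z\<bar>\<close>, and the last term is absorbed
  on the left.\<close>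

lemma linear_bound_from_net:
  fixes f :: "'a::euclidean_space \<Rightarrow> real"
  assumes f: "linear f" and S: "subspace S" and N: "N \<subseteq> S"
    and net: "\<And>x. x \<in> S \<Longrightarrow> norm x \<le> 1 \<Longrightarrow> \<exists>y\<in>N. norm (x - y) \<le> 2/3"
    and bound: "\<And>y. y \<in> N \<Longrightarrow> \<bar>f y\<bar> \<le> \<tau>" and "x \<in> S"
  shows "\<bar>f x\<bar> \<le> 3 * \<tau> * norm x"
proof -
  let ?K = "cball 0 1 \<inter> S"
  have "compact ?K" using S by (intro compact_Int_closed) (auto intro: closed_subspace)
  moreover have "continuous_on ?K (\<lambda>x. \<bar>f x\<bar>)"
    using f by (intro continuous_intros linear_continuous_on linear_linear[THEN iffD2])
  moreover have "0 \<in> ?K" using S by (simp add: subspace_0)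
  ultimately obtain z where z: "z \<in> ?K" and zmax: "\<And>x. x \<in> ?K \<Longrightarrow> \<bar>f x\<bar> \<le> \<bar>f z\<bar>"
    using continuous_attains_sup[of ?K "\<lambda>x. \<bar>f x\<bar>"] by blast
  have scaled: "\<bar>f x\<bar> \<le> \<bar>f z\<bar> * norm x" if "x \<in> S" for x
  proof (cases "x = 0")
    case False
    then have "\<bar>f ((1 / norm x) *\<^sub>R x)\<bar> \<le> \<bar>f z\<bar>" using that S by (intro zmax) (simp add: subspace_scale)
    then show ?thesis using False by (simp add: linear_scale[OF f] abs_mult field_simps)
  qed (simp add: linear_0[OF f])
  obtain y where y: "y \<in> N" "norm (z - y) \<le> 2/3" using net z by auto
  have "\<bar>f z\<bar> \<le> \<bar>f y\<bar> + \<bar>f (z - y)\<bar>" by (simp add: linear_diff[OF f])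
  also have "\<bar>f (z - y)\<bar> \<le> \<bar>f z\<bar> * norm (z - y)"
    using z y N S by (intro scaled subspace_diff) auto
  also have "\<dots> \<le> \<bar>f z\<bar> * (2/3)" using y by (intro mult_left_mono) auto
  finally have "\<bar>f z\<bar> \<le> 3 * \<tau>" using bound[OF y(1)] by simp
  then show ?thesis using scaled[OF \<open>x \<in> S\<close>] mult_right_mono[of "\<bar>f z\<bar>" "3 * \<tau>" "norm x"] by simp
qed

text \<open>The linear bound is used twice: in \<open>u\<close> with \<open>v\<close> fixed in its
  net, then in \<open>v\<close> with \<open>3 * \<tau> * norm u\<close> in place of
  \<open>\<tau>\<close>.\<close>

lemma bilinear_bound_from_nets:
  fixes E :: "real^'n^'m"
  assumes S: "subspace S" "N\<^sub>1 \<subseteq> S" "\<And>x. x \<in> S \<Longrightarrow> norm x \<le> 1 \<Longrightarrow> \<exists>y\<in>N\<^sub>1. norm (x - y) \<le> 2/3"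
    and T: "subspace T" "N\<^sub>2 \<subseteq> T" "\<And>x. x \<in> T \<Longrightarrow> norm x \<le> 1 \<Longrightarrow> \<exists>y\<in>N\<^sub>2. norm (x - y) \<le> 2/3"
    and bound: "\<And>u v. u \<in> N\<^sub>1 \<Longrightarrow> v \<in> N\<^sub>2 \<Longrightarrow> \<bar>u \<bullet> (E *v v)\<bar> \<le> \<tau>" and "u \<in> S" "v \<in> T"
  shows "\<bar>u \<bullet> (E *v v)\<bar> \<le> 9 * \<tau> * norm u * norm v"
proof -
  have "\<bar>u \<bullet> (E *v v)\<bar> \<le> 3 * \<tau> * norm u" if "v \<in> N\<^sub>2" for v
    using that bound \<open>u \<in> S\<close>
    by (intro linear_bound_from_net[OF _ S, of "\<lambda>u. u \<bullet> (E *v v)"])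
       (auto intro: linearI simp: inner_add_left)
  then have "\<bar>u \<bullet> (E *v v)\<bar> \<le> 3 * (3 * \<tau> * norm u) * norm v"
    using \<open>v \<in> T\<close>
    by (intro linear_bound_from_net[OF _ T, of "\<lambda>v. u \<bullet> (E *v v)"])
       (auto intro: linearI simp: matrix_vector_right_distrib matrix_vector_mult_scaleR inner_add_right)
  then show ?thesis by simp
qed

section \<open>Deterministic perturbation bound\<close>

lemma spectral_norm_bound: "norm (E *v x) \<le> spectral_norm E * norm x"
  unfolding spectral_norm_def by (rule onorm[OF matrix_vector_mul_bounded_linear])

lemma spectral_norm_nonneg: "spectral_norm E \<ge> 0"
  unfolding spectral_norm_def by (rule onorm_pos_le[OF matrix_vector_mul_bounded_linear])

lemma spectral_norm_inner_bound: "\<bar>x \<bullet> (E *v y)\<bar> \<le> spectral_norm E * norm x * norm y"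
proof -
  have "\<bar>x \<bullet> (E *v y)\<bar> \<le> norm x * norm (E *v y)" by (rule Cauchy_Schwarz_ineq2)
  also have "\<dots> \<le> norm x * (spectral_norm E * norm y)"
    by (intro mult_left_mono spectral_norm_bound) simp
  finally show ?thesis by (simp add: algebra_simps)
qed

text \<open>Pythagoras: the squared sine is the sum of the squared norms of \<open>b\<close> and
  \<open>q\<close>. The last clause allows a bilinear estimate on \<open>T\<close> to be applied to
  the whole \<open>T\<close>-component of \<open>w\<close>, avoiding separate costs for its parts
  along \<open>v\<close> and \<open>b\<close>.\<close>

lemma sin_angle_decomposition:
  fixes v w :: "'a::euclidean_space"
  assumes T: "subspace T" "v \<in> T" and "norm v = 1" "norm w = 1"
  obtains b q where "w = (v \<bullet> w) *\<^sub>R v + b + q" "b \<in> T" "b \<bullet> v = 0" "\<And>x. x \<in> T \<Longrightarrow> q \<bullet> x = 0"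
    "sin_angle v w \<le> norm b + norm q" "norm ((v \<bullet> w) *\<^sub>R v + b) \<le> 1"
proof -
  obtain y q where y: "y \<in> T" and q: "\<And>x. x \<in> T \<Longrightarrow> q \<bullet> x = 0" and w: "w = y + q"
    using orthogonal_subspace_decomp_exists[of T w] span_eq_iff[of T] T
    by (metis orthogonal_def)
  have vw: "v \<bullet> w = v \<bullet> y" using q[OF T(2)] by (simp add: w inner_add_right inner_commute)
  define b where "b = y - (v \<bullet> w) *\<^sub>R v"
  have vv: "v \<bullet> v = 1" using \<open>norm v = 1\<close> by (simp add: norm_eq_1)
  have bT: "b \<in> T" using y T by (auto simp: b_def intro: subspace_diff subspace_scale)
  have bv: "b \<bullet> v = 0" using vv vw by (simp add: b_def inner_diff_left inner_commute[of y v])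
  have weq: "w = (v \<bullet> w) *\<^sub>R v + b + q" by (simp add: b_def w)
  have yq: "q \<bullet> y = 0" using q y by simp
  have "1 = w \<bullet> w" using \<open>norm w = 1\<close> by (simp add: norm_eq_1)
  also have "\<dots> = y \<bullet> y + q \<bullet> q" using yq by (simp add: w inner_add_left inner_add_right inner_commute)
  finally have w1: "y \<bullet> y + q \<bullet> q = 1" by simp
  have "y = (v \<bullet> w) *\<^sub>R v + b" by (simp add: b_def)
  then have "y \<bullet> y = ((v \<bullet> w) *\<^sub>R v + b) \<bullet> ((v \<bullet> w) *\<^sub>R v + b)" by simp
  also have "\<dots> = (v \<bullet> w)\<^sup>2 + b \<bullet> b"
    using bv vv by (simp add: inner_add_left inner_add_right inner_commute power2_eq_square)
  finally have "1 - (v \<bullet> w)\<^sup>2 = b \<bullet> b + q \<bullet> q" using w1 by simp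
  also have "\<dots> \<le> (norm b + norm q)\<^sup>2"
    by (simp add: power2_sum power2_norm_eq_inner)
  finally have "sin_angle v w \<le> norm b + norm q"
    unfolding sin_angle_def by (intro real_le_lsqrt) auto
  moreover have "y \<bullet> y \<le> 1" using w1 inner_ge_zero[of q] by linarith
  then have "norm ((v \<bullet> w) *\<^sub>R v + b) \<le> 1" by (simp add: b_def norm_eq_sqrt_inner)
  ultimately show thesis using that weq bT bv q by blast
qed

lemma product_le_cancel_norm:
  assumes "c * (norm b)\<^sup>2 \<le> d * norm b" "d \<ge> 0"
  shows "c * norm b \<le> d"
  using assms by (cases "norm b = 0") (auto simp: power2_eq_square mult.assoc[symmetric])

text \<open>Decompose the perturbed singular vectors as \<open>v' = (v \<bullet> v') v + b + q\<close> and
  \<open>u' = (u \<bullet> u') u + a + p\<close>, with \<open>b\<close>, \<open>a\<close> in the row and column space of \<open>A\<close> and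
  \<open>q\<close>, \<open>p\<close> orthogonal to them. Testing the singular vector equations of \<open>A + E\<close> against
  \<open>q\<close> and \<open>p\<close> bounds these by \<open>\<parallel>E\<parallel>/\<sigma>'\<close>; testing against \<open>b\<close> and \<open>a\<close> and adding the two
  inequalities bounds \<open>(\<sigma>' - \<sigma>\<^sub>2) (\<parallel>a\<parallel> + \<parallel>b\<parallel>)\<close>.\<close>

lemma top_singular_vector_perturbation:
  fixes A E :: "real^'n^'m"
  defines "\<sigma> \<equiv> singular_value A 1" and "e \<equiv> spectral_norm E"
    and "\<delta> \<equiv> singular_value A 1 - singular_value A 2"
  assumes \<delta>: "\<delta> > 0"
    and uv: "singular_pair A (singular_value A 1) u v"
    and uv': "singular_pair (A + E) (singular_value (A + E) 1) u' v'"
    and small: "\<bar>u \<bullet> (E *v v)\<bar> \<le> \<delta> / 8"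
    and bound: "\<And>x y. x \<in> range ((*v) A) \<Longrightarrow> y \<in> range ((*v) (transpose A)) \<Longrightarrow>
                  \<bar>x \<bullet> (E *v y)\<bar> \<le> s * norm x * norm y"
    and s: "s \<ge> 0"
  shows "sin_angle v v' \<le> 16/7 * (s / \<delta>) + 8/7 * (e / \<sigma>) + 128/49 * (e\<^sup>2 / (\<sigma> * \<delta>))"
    and "sin_angle u u' \<le> 16/7 * (s / \<delta>) + 8/7 * (e / \<sigma>) + 128/49 * (e\<^sup>2 / (\<sigma> * \<delta>))"
proof -
  define \<sigma>' where "\<sigma>' = singular_value (A + E) 1"
  define \<sigma>2 where "\<sigma>2 = singular_value A 2"
  let ?R = "range ((*v) A)" and ?T = "range ((*v) (transpose A))"
  have \<sigma>2: "\<sigma>2 \<ge> 0" unfolding \<sigma>2_def by (rule singular_value_2_nonneg)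
  have \<delta>_eq: "\<delta> = \<sigma> - \<sigma>2" by (simp add: \<delta>_def \<sigma>_def \<sigma>2_def)
  have \<sigma>: "\<sigma> > 0" using \<delta> \<sigma>2 \<delta>_eq by simp
  have e: "e \<ge> 0" unfolding e_def by (rule spectral_norm_nonneg)
  have unit: "norm u = 1" "norm v = 1" "norm u' = 1" "norm v' = 1"
    using uv uv' by (auto simp: singular_pair_def)
  have Av: "A *v v = \<sigma> *\<^sub>R u" and Au: "transpose A *v u = \<sigma> *\<^sub>R v"
    using uv by (auto simp: singular_pair_def \<sigma>_def)
  have v': "(A + E) *v v' = \<sigma>' *\<^sub>R u'" and u': "transpose (A + E) *v u' = \<sigma>' *\<^sub>R v'"
    using uv' by (auto simp: singular_pair_def \<sigma>'_def)
  \<comment> \<open>\<open>eq1\<close> and \<open>eq2\<close> are the two singular vector equations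
    of \<open>A + E\<close> tested against arbitrary \<open>x\<close> and \<open>y\<close>; all
    later estimates are instances of them.\<close>
  have eq1: "\<sigma>' * (x \<bullet> u') = (transpose A *v x) \<bullet> v' + x \<bullet> (E *v v')" for x
    using arg_cong[OF v', of "\<lambda>z. x \<bullet> z"] inner_transpose_matrix_vector[of A x v']
    by (simp add: matrix_vector_mult_add_rdistrib inner_add_right)
  have eq2: "\<sigma>' * (y \<bullet> v') = (A *v y) \<bullet> u' + u' \<bullet> (E *v y)" for y
    using arg_cong[OF u', of "\<lambda>z. z \<bullet> y"] inner_transpose_matrix_vector[of "A + E" u' y]
    by (simp add: matrix_vector_mult_add_rdistrib inner_add_right inner_commute)
  have subR: "subspace ?R" and subT: "subspace ?T"
    by (intro linear_subspace_image matrix_vector_mul_linear subspace_UNIV)+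
  have "A *v ((1 / \<sigma>) *\<^sub>R v) = u" using Av \<sigma> by (simp add: matrix_vector_mult_scaleR)
  then have uR: "u \<in> ?R" by (metis rangeI)
  have "transpose A *v ((1 / \<sigma>) *\<^sub>R u) = v" using Au \<sigma> by (simp only: matrix_vector_mult_scaleR) simp
  then have vT: "v \<in> ?T" by (metis rangeI)

  have "u \<bullet> ((A + E) *v v) \<le> norm u * norm ((A + E) *v v)" by (rule norm_cauchy_schwarz)
  also have "\<dots> \<le> \<sigma>'"
    using norm_matrix_vector_le_singular_value_1[of "A + E" v] unit by (simp add: \<sigma>'_def)
  also have "u \<bullet> ((A + E) *v v) = \<sigma> + u \<bullet> (E *v v)"
    using unit by (simp add: matrix_vector_mult_add_rdistrib inner_add_right Av norm_eq_1)
  finally have \<sigma>'_ge: "\<sigma>' \<ge> \<sigma> - \<delta> / 8" using small by linarith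
  \<comment> \<open>The second bound uses \<open>\<delta> \<le> \<sigma>\<close>, which holds
    because \<open>\<sigma>2 \<ge> 0\<close>.\<close>
  have \<sigma>'_gap: "\<sigma>' - \<sigma>2 \<ge> 7/8 * \<delta>" and \<sigma>'_pos: "\<sigma>' \<ge> 7/8 * \<sigma>"
    using \<sigma>'_ge \<delta>_eq \<sigma>2 by (simp_all add: field_simps)

  obtain b q where v'_eq: "v' = (v \<bullet> v') *\<^sub>R v + b + q" and bT: "b \<in> ?T" and bv: "b \<bullet> v = 0"
    and q: "\<And>x. x \<in> ?T \<Longrightarrow> q \<bullet> x = 0" and sin_v: "sin_angle v v' \<le> norm b + norm q"
    and v'T: "norm ((v \<bullet> v') *\<^sub>R v + b) \<le> 1"
    using sin_angle_decomposition[OF subT vT unit(2,4)] by blast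
  obtain a p where u'_eq: "u' = (u \<bullet> u') *\<^sub>R u + a + p" and aR: "a \<in> ?R" and au: "a \<bullet> u = 0"
    and p: "\<And>x. x \<in> ?R \<Longrightarrow> p \<bullet> x = 0" and sin_u: "sin_angle u u' \<le> norm a + norm p"
    and u'R: "norm ((u \<bullet> u') *\<^sub>R u + a) \<le> 1"
    using sin_angle_decomposition[OF subR uR unit(1,3)] by blast

  have qv': "q \<bullet> v' = (norm q)\<^sup>2"
    using arg_cong[OF v'_eq, of "\<lambda>z. q \<bullet> z"] q[OF vT] q[OF bT] by (simp add: inner_add_right power2_norm_eq_inner)
  have pu': "p \<bullet> u' = (norm p)\<^sup>2"
    using arg_cong[OF u'_eq, of "\<lambda>z. p \<bullet> z"] p[OF uR] p[OF aR] by (simp add: inner_add_right power2_norm_eq_inner)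
  have bv': "b \<bullet> v' = (norm b)\<^sup>2"
    using arg_cong[OF v'_eq, of "\<lambda>z. b \<bullet> z"] bv q[OF bT] by (simp add: inner_add_right inner_commute power2_norm_eq_inner)
  have au': "a \<bullet> u' = (norm a)\<^sup>2"
    using arg_cong[OF u'_eq, of "\<lambda>z. a \<bullet> z"] au p[OF aR] by (simp add: inner_add_right inner_commute power2_norm_eq_inner)

  \<comment> \<open>The orthogonal complement of the row space is the kernel of \<open>A\<close>:
    test \<open>q\<close> against the row space vector obtained by applying
    \<open>transpose A\<close> to \<open>A *v q\<close>.\<close>
  have "(A *v q) \<bullet> (A *v q) = 0"
    using q[of "transpose A *v (A *v q)"] inner_transpose_matrix_vector[of A "A *v q" q]
    by (simp add: inner_commute del: transpose_matrix_vector)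
  then have Aq: "A *v q = 0" by simp
  have "(transpose A *v p) \<bullet> (transpose A *v p) = 0"
    using p[of "A *v (transpose A *v p)"] inner_transpose_matrix_vector[of A p "transpose A *v p"]
    by (simp del: transpose_matrix_vector)
  then have Ap: "transpose A *v p = 0" by (simp del: transpose_matrix_vector)

  have "\<sigma>' * (norm q)\<^sup>2 \<le> e * norm q"
    using eq2[of q] qv' Aq spectral_norm_inner_bound[of u' E q] unit by (simp add: e_def)
  then have "\<sigma>' * norm q \<le> e" using e by (rule product_le_cancel_norm)
  then have "7/8 * \<sigma> * norm q \<le> e" using mult_right_mono[OF \<sigma>'_pos, of "norm q"] by simp
  then have q_le: "norm q \<le> 8/7 * (e / \<sigma>)" using \<sigma> by (simp add: field_simps)
  have "\<sigma>' * (norm p)\<^sup>2 \<le> e * norm p"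
    using eq1[of p] pu' Ap spectral_norm_inner_bound[of p E v'] unit by (simp add: e_def del: transpose_matrix_vector)
  then have "\<sigma>' * norm p \<le> e" using e by (rule product_le_cancel_norm)
  then have "7/8 * \<sigma> * norm p \<le> e" using mult_right_mono[OF \<sigma>'_pos, of "norm p"] by simp
  then have p_le: "norm p \<le> 8/7 * (e / \<sigma>)" using \<sigma> by (simp add: field_simps)

  \<comment> \<open>Bounds the contribution of E per unit length of \<open>a\<close> or
    \<open>b\<close>: \<open>s\<close> comes from the part inside the row or column space, and
    \<open>e * (8/7 * (e / \<sigma>))\<close> from the small component \<open>p\<close> or
    \<open>q\<close>.\<close>
  define X where "X = s + 8/7 * (e\<^sup>2 / \<sigma>)"
  have X: "X \<ge> 0" using s \<sigma> by (simp add: X_def)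
  have Ab: "norm (A *v b) \<le> \<sigma>2 * norm b"
    using norm_matrix_vector_le_singular_value_2[OF _ uv bv] \<delta> by (simp add: \<delta>_def \<sigma>2_def)
  have "\<bar>a \<bullet> (A *v b)\<bar> \<le> norm a * norm (A *v b)" by (rule Cauchy_Schwarz_ineq2)
  also have "\<dots> \<le> norm a * (\<sigma>2 * norm b)" using Ab by (intro mult_left_mono) auto
  finally have aAb: "a \<bullet> (A *v b) \<le> \<sigma>2 * norm a * norm b" by (simp add: algebra_simps)

  \<comment> \<open>Of the three components of \<open>u'\<close> only \<open>a\<close> meets
    \<open>A *v b\<close>: the \<open>u\<close> part drops out since \<open>b\<close> is orthogonal
    to \<open>v\<close>, the \<open>p\<close> part since \<open>A *v b\<close> lies in the column
    space.\<close>
  have "(A *v b) \<bullet> u = 0"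
    using inner_transpose_matrix_vector[of A u b] bv Au by (simp add: inner_commute)
  then have "(A *v b) \<bullet> u' = a \<bullet> (A *v b)"
    using arg_cong[OF u'_eq, of "\<lambda>z. (A *v b) \<bullet> z"] p[of "A *v b"] by (simp add: inner_add_right inner_commute)
  moreover have "u' \<bullet> (E *v b) \<le> X * norm b"
  proof -
    let ?y = "(u \<bullet> u') *\<^sub>R u + a"
    have "?y \<in> ?R" using subR uR aR by (intro subspace_add subspace_scale)
    then have "?y \<bullet> (E *v b) \<le> s * norm ?y * norm b" using bound bT by (metis abs_le_D1)
    also have "\<dots> \<le> s * 1 * norm b" using u'R s by (intro mult_right_mono mult_left_mono) auto
    finally have 1: "?y \<bullet> (E *v b) \<le> s * norm b" by simp
    have "p \<bullet> (E *v b) \<le> e * norm p * norm b"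
      using spectral_norm_inner_bound[of p E b] by (simp add: e_def)
    also have "\<dots> \<le> e * (8/7 * (e / \<sigma>)) * norm b" using p_le e by (intro mult_right_mono mult_left_mono) auto
    finally have 2: "p \<bullet> (E *v b) \<le> 8/7 * (e\<^sup>2 / \<sigma>) * norm b" by (simp add: power2_eq_square)
    have "u' \<bullet> (E *v b) = ?y \<bullet> (E *v b) + p \<bullet> (E *v b)"
      by (subst u'_eq) (simp add: inner_add_left)
    then show ?thesis using 1 2 by (simp add: X_def algebra_simps)
  qed
  ultimately have "\<sigma>' * (norm b)\<^sup>2 \<le> (\<sigma>2 * norm a + X) * norm b"
    using eq2[of b] bv' aAb by (simp add: algebra_simps)
  then have b_le: "\<sigma>' * norm b \<le> \<sigma>2 * norm a + X"
    using X \<sigma>2 by (intro product_le_cancel_norm) auto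

  have "(transpose A *v a) \<bullet> v = 0"
    using inner_transpose_matrix_vector[of A a v] au Av by simp
  then have "(transpose A *v a) \<bullet> v' = a \<bullet> (A *v b)"
    using arg_cong[OF v'_eq, of "\<lambda>z. (transpose A *v a) \<bullet> z"] q[of "transpose A *v a"]
      inner_transpose_matrix_vector[of A a b]
    by (simp add: inner_add_right inner_commute del: transpose_matrix_vector)
  moreover have "a \<bullet> (E *v v') \<le> X * norm a"
  proof -
    let ?y = "(v \<bullet> v') *\<^sub>R v + b"
    have "?y \<in> ?T" using subT vT bT by (intro subspace_add subspace_scale)
    then have "a \<bullet> (E *v ?y) \<le> s * norm a * norm ?y" using bound aR by (metis abs_le_D1)
    also have "\<dots> \<le> s * norm a * 1" using v'T s by (intro mult_left_mono) auto
    finally have 1: "a \<bullet> (E *v ?y) \<le> s * norm a" by simp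
    have "a \<bullet> (E *v q) \<le> e * norm a * norm q"
      using spectral_norm_inner_bound[of a E q] by (simp add: e_def)
    also have "\<dots> \<le> e * norm a * (8/7 * (e / \<sigma>))" using q_le e by (intro mult_left_mono) auto
    finally have 2: "a \<bullet> (E *v q) \<le> 8/7 * (e\<^sup>2 / \<sigma>) * norm a"
      by (simp add: power2_eq_square mult_ac)
    have "a \<bullet> (E *v v') = a \<bullet> (E *v ?y) + a \<bullet> (E *v q)"
      by (subst v'_eq) (simp add: inner_add_right matrix_vector_right_distrib)
    then show ?thesis using 1 2 by (simp add: X_def algebra_simps)
  qed
  ultimately have "\<sigma>' * (norm a)\<^sup>2 \<le> (\<sigma>2 * norm b + X) * norm a"
    using eq1[of a] au' aAb by (simp add: algebra_simps)
  then have a_le: "\<sigma>' * norm a \<le> \<sigma>2 * norm b + X"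
    using X \<sigma>2 by (intro product_le_cancel_norm) auto

  \<comment> \<open>Adding \<open>a_le\<close> and \<open>b_le\<close> moves the cross terms with
    \<open>\<sigma>2\<close> to the left; then 16/7 is 2 divided by 7/8, and 128/49 is 16/7 times
    the 8/7 in \<open>X\<close>.\<close>
  have "(7/8 * \<delta>) * (norm a + norm b) \<le> (\<sigma>' - \<sigma>2) * (norm a + norm b)"
    using \<sigma>'_gap by (intro mult_right_mono) auto
  also have "\<dots> \<le> 2 * X" using a_le b_le by (simp add: algebra_simps)
  finally have "norm a + norm b \<le> 16/7 * (X / \<delta>)" using \<delta> by (simp add: field_simps)
  also have "\<dots> = 16/7 * (s / \<delta>) + 128/49 * (e\<^sup>2 / (\<sigma> * \<delta>))"
    by (simp add: X_def add_divide_distrib algebra_simps)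
  finally have ab: "norm a + norm b \<le> 16/7 * (s / \<delta>) + 128/49 * (e\<^sup>2 / (\<sigma> * \<delta>))" .
  show "sin_angle v v' \<le> 16/7 * (s / \<delta>) + 8/7 * (e / \<sigma>) + 128/49 * (e\<^sup>2 / (\<sigma> * \<delta>))"
    using ab sin_v q_le norm_ge_zero[of a] by linarith
  show "sin_angle u u' \<le> 16/7 * (s / \<delta>) + 8/7 * (e / \<sigma>) + 128/49 * (e\<^sup>2 / (\<sigma> * \<delta>))"
    using ab sin_u p_le norm_ge_zero[of b] by linarith
qed

section \<open>Measurability and probability\<close>

lemma singular_value_1_attained:
  fixes A :: "real^'n^'m"
  obtains x where "norm x = 1" "norm (A *v x) = singular_value A 1"
proof -
  obtain B \<nu> where B: "gram_eigenbasis A B \<nu>" using gram_eigenbasis_exists .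
  obtain b0 where b0: "b0 \<in> B" "singular_value A 1 = sqrt (\<nu> b0)"
    by (rule gram_eigenbasis_top[OF B]) blast
  have "(norm (A *v b0))\<^sup>2 = \<nu> b0" using b0(1) by (rule norm_matrix_vector_gram_basis_vector[OF B])
  then have "norm (A *v b0) = singular_value A 1" using b0(2) by (metis norm_ge_zero real_sqrt_unique)
  then show thesis using that[of b0] B b0(1) by (auto simp: gram_eigenbasis_def)
qed

text \<open>Replaces the singular value by \<open>u \<bullet> (B *v v)\<close> and its maximality by
  one weak inequality for each \<open>x\<close>. All conditions are then closed in \<open>u\<close>,
  \<open>v\<close> and \<open>B\<close> jointly, with no appeal to continuity of
  \<open>singular_value\<close>.\<close>

lemma top_singular_pair_iff:
  fixes B :: "real^'n^'m"
  shows "singular_pair B (singular_value B 1) u v \<longleftrightarrow>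
    norm u = 1 \<and> norm v = 1 \<and> B *v v = (u \<bullet> (B *v v)) *\<^sub>R u \<and> transpose B *v u = (u \<bullet> (B *v v)) *\<^sub>R v \<and>
    (\<forall>x. norm (B *v x) \<le> (u \<bullet> (B *v v)) * norm x)"
proof
  assume p: "singular_pair B (singular_value B 1) u v"
  then have "u \<bullet> (B *v v) = singular_value B 1" by (simp add: singular_pair_def norm_eq_1)
  then show "norm u = 1 \<and> norm v = 1 \<and> B *v v = (u \<bullet> (B *v v)) *\<^sub>R u \<and> transpose B *v u = (u \<bullet> (B *v v)) *\<^sub>R v \<and>
    (\<forall>x. norm (B *v x) \<le> (u \<bullet> (B *v v)) * norm x)"
    using p norm_matrix_vector_le_singular_value_1[of B] unfolding singular_pair_def by metis
next
  assume R: "norm u = 1 \<and> norm v = 1 \<and> B *v v = (u \<bullet> (B *v v)) *\<^sub>R u \<and> transpose B *v u = (u \<bullet> (B *v v)) *\<^sub>R v \<and>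
    (\<forall>x. norm (B *v x) \<le> (u \<bullet> (B *v v)) * norm x)"
  obtain x where "norm x = 1" "norm (B *v x) = singular_value B 1" using singular_value_1_attained .
  then have 1: "singular_value B 1 \<le> u \<bullet> (B *v v)" using R by (metis mult.right_neutral)
  have "u \<bullet> (B *v v) \<le> norm u * norm (B *v v)" by (rule norm_cauchy_schwarz)
  also have "\<dots> \<le> singular_value B 1" using norm_matrix_vector_le_singular_value_1[of B v] R by simp
  finally have "u \<bullet> (B *v v) = singular_value B 1" using 1 by simp
  then show "singular_pair B (singular_value B 1) u v"
    using R unfolding singular_pair_def by metis
qed

text \<open>A convex function on a finite-dimensional space is continuous.\<close>

lemma continuous_on_spectral_norm: "continuous_on UNIV (spectral_norm :: real^'n^'m \<Rightarrow> real)"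
proof (rule convex_on_continuous[OF open_UNIV], rule convex_onI)
  fix t :: real and X Y :: "real^'n^'m"
  assume t: "0 < t" "t < 1"
  let ?Z = "(1 - t) *\<^sub>R X + t *\<^sub>R Y"
  have "norm (?Z *v x) \<le> ((1 - t) * spectral_norm X + t * spectral_norm Y) * norm x" for x
  proof -
    have "?Z *v x = (1 - t) *\<^sub>R (X *v x) + t *\<^sub>R (Y *v x)"
      by (simp add: matrix_vector_mult_add_rdistrib scaleR_matrix_vector_assoc)
    then have "norm (?Z *v x) \<le> (1 - t) * norm (X *v x) + t * norm (Y *v x)"
      using t norm_triangle_ineq[of "(1 - t) *\<^sub>R (X *v x)" "t *\<^sub>R (Y *v x)"] by simp
    also have "\<dots> \<le> (1 - t) * (spectral_norm X * norm x) + t * (spectral_norm Y * norm x)"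
      using t by (intro add_mono mult_left_mono spectral_norm_bound) auto
    finally show ?thesis by (simp add: algebra_simps)
  qed
  then show "spectral_norm ?Z \<le> (1 - t) * spectral_norm X + t * spectral_norm Y"
    unfolding spectral_norm_def[of ?Z] by (rule onorm_le)
qed simp

lemma continuous_on_matrix_vector_mult [continuous_intros]:
  fixes X :: "'a::topological_space \<Rightarrow> real^'n^'m"
  assumes "continuous_on S X" "continuous_on S y"
  shows "continuous_on S (\<lambda>z. X z *v y z)"
  unfolding matrix_vector_mult_def using assms
  by (intro continuous_intros)

lemma continuous_on_transpose [continuous_intros]:
  fixes X :: "'a::topological_space \<Rightarrow> real^'n^'m"
  assumes "continuous_on S X"
  shows "continuous_on S (\<lambda>z. transpose (X z))"
  unfolding transpose_def using assms
  by (intro continuous_intros)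

lemma closed_top_singular_pairs:
  fixes A :: "real^'n^'m"
  shows "closed {z. singular_pair (A + snd z) (singular_value (A + snd z) 1) (fst (fst z)) (snd (fst z))}"
  unfolding top_singular_pair_iff
  by (intro closed_Collect_conj closed_Collect_all closed_Collect_eq closed_Collect_le continuous_intros)

text \<open>The complement is a countable union of projections of closed sets along the compact set of
  pairs of unit vectors, hence an \<open>F\<^sub>\<sigma>\<close> set.\<close>

lemma borel_top_singular_pairs_bound:
  fixes A :: "real^'n^'m" and f :: "(real^'m) \<times> (real^'n) \<Rightarrow> real"
  assumes f: "continuous_on UNIV f" and g: "continuous_on UNIV g"
  shows "{X. \<forall>u v. singular_pair (A + X) (singular_value (A + X) 1) u v \<longrightarrow> f (u, v) \<le> g X} \<in> sets borel"
    (is "?Z \<in> _")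
proof -
  let ?P = "\<lambda>u v X. singular_pair (A + X) (singular_value (A + X) 1) u v"
  \<comment> \<open>The strict inequality \<open>g X < f (u, v)\<close> is not a closed condition; a
    margin of \<open>inverse (real (Suc n))\<close> makes it one, and the union over
    \<open>n\<close> recovers it.\<close>
  define D where "D n = {z. ?P (fst (fst z)) (snd (fst z)) (snd z)} \<inter>
     {z. g (snd z) + inverse (real (Suc n)) \<le> f (fst z)}" for n
  define F where "F n = {X. \<exists>p. p \<in> sphere 0 1 \<times> sphere 0 1 \<and> (p, X) \<in> D n}" for n
  have "closed (D n)" for n
    unfolding D_def
    by (intro closed_Int closed_top_singular_pairs closed_Collect_le continuous_intros
        continuous_on_compose2[OF f] continuous_on_compose2[OF g]) auto
  then have "closed (F n)" for n
    unfolding F_def by (intro closed_compact_projection compact_Times) auto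
  moreover have "- ?Z = (\<Union>n. F n)"
  proof (intro set_eqI iffI)
    fix X assume "X \<in> - ?Z"
    then obtain u v where p: "?P u v X" and "g X < f (u, v)" by auto
    then obtain n where "inverse (real (Suc n)) < f (u, v) - g X" using reals_Archimedean[of "f (u, v) - g X"] by auto
    moreover have "u \<in> sphere 0 1" "v \<in> sphere 0 1" using p by (auto simp: singular_pair_def)
    ultimately have "X \<in> F n" using p unfolding F_def D_def by (intro CollectI exI[of _ "(u, v)"]) auto
    then show "X \<in> (\<Union>n. F n)" by blast
  next
    fix X assume "X \<in> (\<Union>n. F n)"
    then obtain n u v where p: "?P u v X" and le: "g X + inverse (real (Suc n)) \<le> f (u, v)"
      unfolding F_def D_def by auto
    have "inverse (real (Suc n)) > 0" by simp
    with le have "g X < f (u, v)" by linarith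
    with p show "X \<in> - ?Z" by fastforce
  qed
  ultimately have "- ?Z \<in> sets borel" by auto
  then have "- (- ?Z) \<in> sets borel" by (rule borel_comp)
  then show ?thesis by simp
qed

section \<open>Tail bounds and the probability estimate\<close>

lemma measurable_bilinear_form:
  fixes E :: "'a \<Rightarrow> real^'n^'m"
  assumes "E \<in> borel_measurable M"
  shows "(\<lambda>\<omega>. u \<bullet> (E \<omega> *v v)) \<in> borel_measurable M"
  using assms by (rule borel_measurable_continuous_on[rotated]) (intro continuous_intros)

text \<open>Net points need not be unit vectors. Rescaling nonzero ones to length 1 can only enlarge
  the bilinear form, and for a zero vector the event is empty.\<close>

lemma concentrated_unit_ball:
  fixes E :: "'a \<Rightarrow> real^'n^'m"
  assumes "prob_space M" and E: "E \<in> borel_measurable M" and conc: "concentrated M E C\<^sub>1 c\<^sub>1 \<gamma>" and "C\<^sub>1 > 0"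
    and u: "norm u \<le> 1" and v: "norm v \<le> 1" and "\<tau> > 0"
  shows "measure M {\<omega> \<in> space M. \<bar>u \<bullet> (E \<omega> *v v)\<bar> > \<tau>} \<le> C\<^sub>1 * exp (- c\<^sub>1 * \<tau> powr \<gamma>)"
proof (cases "u = 0 \<or> v = 0")
  case True
  then have "{\<omega> \<in> space M. \<bar>u \<bullet> (E \<omega> *v v)\<bar> > \<tau>} = {}" using \<open>\<tau> > 0\<close> by auto
  then show ?thesis using \<open>C\<^sub>1 > 0\<close> by (simp only: measure_empty) simp
next
  case False
  interpret prob_space M by fact
  let ?u = "(1 / norm u) *\<^sub>R u" and ?v = "(1 / norm v) *\<^sub>R v"
  note [measurable] = measurable_bilinear_form[OF E]
  have le: "\<bar>u \<bullet> (X *v v)\<bar> \<le> \<bar>?u \<bullet> (X *v ?v)\<bar>" for X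
  proof -
    have "u \<bullet> (X *v v) = (norm u * norm v) * (?u \<bullet> (X *v ?v))"
      using False by (simp add: matrix_vector_mult_scaleR)
    then have "\<bar>u \<bullet> (X *v v)\<bar> = (norm u * norm v) * \<bar>?u \<bullet> (X *v ?v)\<bar>" by (simp add: abs_mult)
    also have "\<dots> \<le> 1 * \<bar>?u \<bullet> (X *v ?v)\<bar>" using u v by (intro mult_right_mono mult_le_one) auto
    finally show ?thesis by simp
  qed
  have "prob {\<omega> \<in> space M. \<bar>u \<bullet> (E \<omega> *v v)\<bar> > \<tau>} \<le> prob {\<omega> \<in> space M. \<bar>?u \<bullet> (E \<omega> *v ?v)\<bar> > \<tau>}"
  proof (rule finite_measure_mono)
    show "{\<omega> \<in> space M. \<bar>u \<bullet> (E \<omega> *v v)\<bar> > \<tau>} \<subseteq> {\<omega> \<in> space M. \<bar>?u \<bullet> (E \<omega> *v ?v)\<bar> > \<tau>}"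
      using le by (auto intro: less_le_trans)
    show "{\<omega> \<in> space M. \<bar>?u \<bullet> (E \<omega> *v ?v)\<bar> > \<tau>} \<in> sets M" by measurable
  qed
  also have "\<dots> \<le> C\<^sub>1 * exp (- c\<^sub>1 * \<tau> powr \<gamma>)"
  proof -
    have "norm ?u = 1" "norm ?v = 1" using False by auto
    then show ?thesis using conc \<open>\<tau> > 0\<close> unfolding concentrated_def by blast
  qed
  finally show ?thesis .
qed

text \<open>Union bound over at most \<open>9 ^ r * 9 ^ r\<close> pairs of net points. Only finitely
  many events make up \<open>Z\<close>, yet off \<open>Z\<close> the bound holds for all
  \<open>u\<close> and \<open>v\<close> at once.\<close>

lemma bilinear_form_bound_event:
  fixes E :: "'a \<Rightarrow> real^'n^'m"
  assumes "prob_space M" and E: "E \<in> borel_measurable M" and conc: "concentrated M E C\<^sub>1 c\<^sub>1 \<gamma>" and "C\<^sub>1 > 0"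
    and S: "subspace S" "dim S = r" and T: "subspace T" "dim T = r" and "\<tau> > 0"
  obtains Z where "Z \<in> sets M" "measure M Z \<le> 9 ^ (2 * r) * (C\<^sub>1 * exp (- c\<^sub>1 * \<tau> powr \<gamma>))"
    "\<And>\<omega> u v. \<omega> \<in> space M - Z \<Longrightarrow> u \<in> S \<Longrightarrow> v \<in> T \<Longrightarrow> \<bar>u \<bullet> (E \<omega> *v v)\<bar> \<le> 9 * \<tau> * norm u * norm v"
proof -
  interpret prob_space M by fact
  note [measurable] = measurable_bilinear_form[OF E]
  obtain N\<^sub>1 where N1: "finite N\<^sub>1" "N\<^sub>1 \<subseteq> S" "N\<^sub>1 \<subseteq> cball 0 1" "card N\<^sub>1 \<le> 9 ^ dim S"
    "\<And>x. x \<in> S \<Longrightarrow> norm x \<le> 1 \<Longrightarrow> \<exists>y\<in>N\<^sub>1. norm (x - y) \<le> 2/3" using unit_ball_net_exists[OF S(1)] by blast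
  obtain N\<^sub>2 where N2: "finite N\<^sub>2" "N\<^sub>2 \<subseteq> T" "N\<^sub>2 \<subseteq> cball 0 1" "card N\<^sub>2 \<le> 9 ^ dim T"
    "\<And>x. x \<in> T \<Longrightarrow> norm x \<le> 1 \<Longrightarrow> \<exists>y\<in>N\<^sub>2. norm (x - y) \<le> 2/3" using unit_ball_net_exists[OF T(1)] by blast
  define Y where "Y p = {\<omega> \<in> space M. \<bar>fst p \<bullet> (E \<omega> *v snd p)\<bar> > \<tau>}" for p
  define Z where "Z = (\<Union>p\<in>N\<^sub>1 \<times> N\<^sub>2. Y p)"
  have Y: "Y p \<in> sets M" for p unfolding Y_def by measurable
  then have Z: "Z \<in> sets M" unfolding Z_def using N1(1) N2(1) by (intro sets.finite_UN) auto
  let ?c = "C\<^sub>1 * exp (- c\<^sub>1 * \<tau> powr \<gamma>)"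
  have "card (N\<^sub>1 \<times> N\<^sub>2) \<le> 9 ^ r * 9 ^ r"
    using N1(4) N2(4) S(2) T(2) by (simp add: card_cartesian_product mult_le_mono)
  also have "\<dots> = 9 ^ (2 * r)" by (simp add: mult_2 power_add)
  finally have "real (card (N\<^sub>1 \<times> N\<^sub>2)) \<le> real (9 ^ (2 * r))" by (simp only: of_nat_le_iff)
  then have card: "real (card (N\<^sub>1 \<times> N\<^sub>2)) \<le> 9 ^ (2 * r)" by simp
  have "prob Z \<le> (\<Sum>p\<in>N\<^sub>1 \<times> N\<^sub>2. prob (Y p))"
    unfolding Z_def using N1(1) N2(1) Y by (intro finite_measure_subadditive_finite) auto
  also have "\<dots> \<le> (\<Sum>p\<in>N\<^sub>1 \<times> N\<^sub>2. ?c)"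
  proof (rule sum_mono)
    fix p assume "p \<in> N\<^sub>1 \<times> N\<^sub>2"
    then have "norm (fst p) \<le> 1" "norm (snd p) \<le> 1" using N1(3) N2(3) by auto
    then show "prob (Y p) \<le> ?c"
      unfolding Y_def using assms by (intro concentrated_unit_ball) auto
  qed
  also have "\<dots> = real (card (N\<^sub>1 \<times> N\<^sub>2)) * ?c" by simp
  also have "\<dots> \<le> 9 ^ (2 * r) * ?c" using card \<open>C\<^sub>1 > 0\<close> by (intro mult_right_mono) auto
  finally have "prob Z \<le> 9 ^ (2 * r) * ?c" .
  moreover have "\<bar>u \<bullet> (E \<omega> *v v)\<bar> \<le> 9 * \<tau> * norm u * norm v"
    if "\<omega> \<in> space M - Z" "u \<in> S" "v \<in> T" for \<omega> u v
  proof (rule bilinear_bound_from_nets[OF S(1) N1(2,5) T(1) N2(2,5) _ that(2,3)])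
    fix x y assume "x \<in> N\<^sub>1" "y \<in> N\<^sub>2"
    then show "\<bar>x \<bullet> (E \<omega> *v y)\<bar> \<le> \<tau>" using that(1) by (force simp: Z_def Y_def)
  qed
  ultimately show thesis using that[OF Z] by blast
qed

text \<open>The function \<open>f\<close> stands for the sine of the right or of the left angle, so
  that both halves of the theorem share one argument; its continuity serves the measurability of the
  event.\<close>

lemma perturbation_bound_probability:
  fixes E :: "'a \<Rightarrow> real^'n^'m" and A :: "real^'n^'m"
  assumes M: "prob_space M" and E: "E \<in> borel_measurable M" and C: "C\<^sub>1 > 0" and \<gamma>: "\<gamma> > 0"
    and conc: "concentrated M E C\<^sub>1 c\<^sub>1 \<gamma>" and r: "rank A = r"
    and \<delta>: "\<delta> = singular_value A 1 - singular_value A 2" "\<delta> > 0" and t: "t > 0"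
    and uv: "singular_pair A (singular_value A 1) u v"
    and f: "continuous_on UNIV (\<lambda>p. f (fst p) (snd p))"
    and f_sin: "\<And>u' v'. f u' v' = sin_angle v v' \<or> f u' v' = sin_angle u u'"
  shows "measure M {\<omega> \<in> space M. \<forall>u' v'. singular_pair (A + E \<omega>) (singular_value (A + E \<omega>) 1) u' v' \<longrightarrow>
            ereal (f u' v') \<le> ereal (4 * sqrt 2) *
              (equot (t * real r powr (1 / \<gamma>)) \<delta>
               + equot (spectral_norm (E \<omega>)) (singular_value A 1)
               + equot ((spectral_norm (E \<omega>))\<^sup>2) (singular_value A 1 * \<delta>))}
        \<ge> 1 - 54 * C\<^sub>1 * exp (- c\<^sub>1 * (\<delta> powr \<gamma> / 8 powr \<gamma>))
            - 2 * C\<^sub>1 * 9 ^ (2 * r) * exp (- c\<^sub>1 * real r * (t powr \<gamma> / 4 powr \<gamma>))"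
    (is "measure M ?good \<ge> _")
proof -
  interpret prob_space M by fact
  define \<sigma> where "\<sigma> = singular_value A 1"
  have \<sigma>: "\<sigma> > 0" using \<delta> singular_value_2_nonneg[of A] by (simp add: \<sigma>_def)
  have "A \<noteq> 0"
  proof
    assume "A = 0"
    then have "\<sigma> *\<^sub>R u = 0" using uv by (simp add: singular_pair_def \<sigma>_def)
    then show False using \<sigma> uv by (auto simp: singular_pair_def)
  qed
  \<comment> \<open>Positivity of \<open>r\<close> makes \<open>s\<close> positive, as the
    concentration hypothesis demands of a threshold.\<close>
  then have r_pos: "r > 0" using r rank_eq_0[of A] by auto
  define s where "s = t * real r powr (1 / \<gamma>)"
  have s: "s > 0" using t r_pos by (simp add: s_def)
  define g where "g X = 4 * sqrt 2 * (s / \<delta> + spectral_norm X / \<sigma> + (spectral_norm X)\<^sup>2 / (\<sigma> * \<delta>))"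
    for X :: "real^'n^'m"
  have "continuous_on UNIV g"
    unfolding g_def using \<sigma> \<delta>(2) by (intro continuous_intros continuous_on_spectral_norm) auto
  note Z_borel = borel_top_singular_pairs_bound[OF f this, of A]
  have bound_eq: "ereal (4 * sqrt 2) *
              (equot (t * real r powr (1 / \<gamma>)) \<delta>
               + equot (spectral_norm (E \<omega>)) (singular_value A 1)
               + equot ((spectral_norm (E \<omega>))\<^sup>2) (singular_value A 1 * \<delta>)) = ereal (g (E \<omega>))" for \<omega>
    unfolding equot_def \<sigma>_def[symmetric] s_def[symmetric] g_def using \<sigma> \<delta>(2) by simp
  have good_eq: "?good = E -` {X. \<forall>u' v'. singular_pair (A + X) (singular_value (A + X) 1) u' v' \<longrightarrow> f u' v' \<le> g X} \<inter> space M"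
    unfolding bound_eq by auto
  have good: "?good \<in> sets M"
    unfolding good_eq using measurable_sets[OF E Z_borel] by simp
  let ?R = "range ((*v) A)" and ?T = "range ((*v) (transpose A))"
  have subR: "subspace ?R" and subT: "subspace ?T"
    by (intro linear_subspace_image matrix_vector_mul_linear subspace_UNIV)+
  have dimR: "dim ?R = r" using r rank_dim_range[of A] by simp
  have dimT: "dim ?T = r" using r rank_dim_range[of "transpose A"] by (simp add: rank_transpose del: transpose_matrix_vector)
  \<comment> \<open>The threshold \<open>s / 4\<close> is chosen so that its power
    \<open>\<gamma>\<close> is \<open>real r * (t powr \<gamma> / 4 powr \<gamma>)\<close>, the
    exponent in the claim.\<close>
  obtain Z where Z: "Z \<in> sets M" "prob Z \<le> 9 ^ (2 * r) * (C\<^sub>1 * exp (- c\<^sub>1 * (s / 4) powr \<gamma>))"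
    "\<And>\<omega> u v. \<omega> \<in> space M - Z \<Longrightarrow> u \<in> ?R \<Longrightarrow> v \<in> ?T \<Longrightarrow> \<bar>u \<bullet> (E \<omega> *v v)\<bar> \<le> 9 * (s / 4) * norm u * norm v"
    using bilinear_form_bound_event[OF M E conc C subR dimR subT dimT, of "s / 4"] s by auto
  define Y where "Y = {\<omega> \<in> space M. \<bar>u \<bullet> (E \<omega> *v v)\<bar> > \<delta> / 8}"
  note [measurable] = measurable_bilinear_form[OF E]
  have Y: "Y \<in> sets M" unfolding Y_def by measurable
  have probY: "prob Y \<le> C\<^sub>1 * exp (- c\<^sub>1 * (\<delta> / 8) powr \<gamma>)"
    unfolding Y_def using uv \<delta>(2)
    by (intro conc[unfolded concentrated_def, rule_format]) (auto simp: singular_pair_def)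
  have "space M - (Y \<union> Z) \<subseteq> ?good"
  proof
    fix \<omega> assume \<omega>: "\<omega> \<in> space M - (Y \<union> Z)"
    have small: "\<bar>u \<bullet> (E \<omega> *v v)\<bar> \<le> \<delta> / 8" using \<omega> by (auto simp: Y_def)
    have "f u' v' \<le> g (E \<omega>)" if p: "singular_pair (A + E \<omega>) (singular_value (A + E \<omega>) 1) u' v'" for u' v'
    proof -
      let ?e = "spectral_norm (E \<omega>)"
      have e: "?e \<ge> 0" by (rule spectral_norm_nonneg)
      have "f u' v' \<le> 16/7 * (9 * (s / 4) / \<delta>) + 8/7 * (?e / \<sigma>) + 128/49 * (?e\<^sup>2 / (\<sigma> * \<delta>))"
        using top_singular_vector_perturbation[of A u v "E \<omega>" u' v' "9 * (s / 4)"]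
          f_sin[of u' v'] \<delta> uv p small Z(3)[of \<omega>] \<omega> s by (auto simp: \<sigma>_def)
      also have "\<dots> = 36/7 * (s / \<delta>) + 8/7 * (?e / \<sigma>) + 128/49 * (?e\<^sup>2 / (\<sigma> * \<delta>))" by simp
      also have "\<dots> \<le> 4 * sqrt 2 * (s / \<delta>) + 4 * sqrt 2 * (?e / \<sigma>) + 4 * sqrt 2 * (?e\<^sup>2 / (\<sigma> * \<delta>))"
      proof -
        \<comment> \<open>Exactly what the first coefficient needs, since 36/7 = 4 * 9/7; the
          coefficients 8/7 and 128/49 are smaller.\<close>
        have "9/7 \<le> sqrt 2" by (rule real_le_rsqrt) (simp add: power2_eq_square)
        then show ?thesis using s \<sigma> \<delta>(2) e
          by (intro add_mono mult_right_mono) auto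
      qed
      finally show ?thesis by (simp add: g_def algebra_simps)
    qed
    then show "\<omega> \<in> ?good" using \<omega> unfolding good_eq by auto
  qed
  then have "prob (space M - (Y \<union> Z)) \<le> prob ?good" using good by (rule finite_measure_mono)
  moreover have "prob (space M - (Y \<union> Z)) = 1 - prob (Y \<union> Z)" using Y Z(1) by (intro prob_compl) auto
  moreover have "prob (Y \<union> Z) \<le> prob Y + prob Z" using Y Z(1) by (intro measure_Un_le)
  moreover have "(\<delta> / 8) powr \<gamma> = \<delta> powr \<gamma> / 8 powr \<gamma>" by (rule powr_divide)
  moreover have "(s / 4) powr \<gamma> = real r * (t powr \<gamma> / 4 powr \<gamma>)"
  proof -
    have "(s / 4) powr \<gamma> = s powr \<gamma> / 4 powr \<gamma>" by (rule powr_divide)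
    also have "s powr \<gamma> = t powr \<gamma> * real r"
      unfolding s_def using t \<gamma> r_pos by (simp add: powr_mult powr_powr)
    finally show ?thesis by simp
  qed
  \<comment> \<open>The event \<open>Y\<close> costs one application of the tail bound and
    \<open>Z\<close> costs \<open>9 ^ (2 * r)\<close> of them; both are relaxed to the coefficients
    of the claim.\<close>
  moreover have "C\<^sub>1 * exp (- c\<^sub>1 * (\<delta> powr \<gamma> / 8 powr \<gamma>)) \<le> 54 * C\<^sub>1 * exp (- c\<^sub>1 * (\<delta> powr \<gamma> / 8 powr \<gamma>))"
    using C by simp
  moreover have "9 ^ (2 * r) * (C\<^sub>1 * exp (- c\<^sub>1 * (real r * (t powr \<gamma> / 4 powr \<gamma>))))
      \<le> 2 * C\<^sub>1 * 9 ^ (2 * r) * exp (- c\<^sub>1 * real r * (t powr \<gamma> / 4 powr \<gamma>))"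
    using C by (simp add: mult.assoc)
  ultimately show ?thesis using probY Z(2) by (simp only:)
qed

theorem theorem14:
  fixes M :: "'a measure"
    and E :: "'a \<Rightarrow> real^'n^'m"
    and A :: "real^'n^'m"
    and C\<^sub>1 c\<^sub>1 \<gamma> \<delta> t :: real
    and r :: nat
  assumes "prob_space M"
    and "E \<in> borel_measurable M"
    and "C\<^sub>1 > 0" and "c\<^sub>1 > 0" and "\<gamma> > 0"
    and "concentrated M E C\<^sub>1 c\<^sub>1 \<gamma>"
    and "rank A = r"
    and "\<delta> = singular_value A 1 - singular_value A 2"
    and "t > 0"
  shows
    "(\<forall>v\<^sub>1. top_right_singular_vector A v\<^sub>1 \<longrightarrow>
        measure M {\<omega> \<in> space M. \<forall>v\<^sub>1'. top_right_singular_vector (A + E \<omega>) v\<^sub>1' \<longrightarrow>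
            ereal (sin_angle v\<^sub>1 v\<^sub>1') \<le> ereal (4 * sqrt 2) *
              (equot (t * real r powr (1 / \<gamma>)) \<delta>
               + equot (spectral_norm (E \<omega>)) (singular_value A 1)
               + equot ((spectral_norm (E \<omega>))\<^sup>2) (singular_value A 1 * \<delta>))}
        \<ge> 1 - 54 * C\<^sub>1 * exp (- c\<^sub>1 * (\<delta> powr \<gamma> / 8 powr \<gamma>))
            - 2 * C\<^sub>1 * 9 ^ (2 * r) * exp (- c\<^sub>1 * real r * (t powr \<gamma> / 4 powr \<gamma>)))
     \<and>
     (\<forall>u\<^sub>1. top_left_singular_vector A u\<^sub>1 \<longrightarrow>
        measure M {\<omega> \<in> space M. \<forall>u\<^sub>1'. top_left_singular_vector (A + E \<omega>) u\<^sub>1' \<longrightarrow>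
            ereal (sin_angle u\<^sub>1 u\<^sub>1') \<le> ereal (4 * sqrt 2) *
              (equot (t * real r powr (1 / \<gamma>)) \<delta>
               + equot (spectral_norm (E \<omega>)) (singular_value A 1)
               + equot ((spectral_norm (E \<omega>))\<^sup>2) (singular_value A 1 * \<delta>))}
        \<ge> 1 - 54 * C\<^sub>1 * exp (- c\<^sub>1 * (\<delta> powr \<gamma> / 8 powr \<gamma>))
            - 2 * C\<^sub>1 * 9 ^ (2 * r) * exp (- c\<^sub>1 * real r * (t powr \<gamma> / 4 powr \<gamma>)))"
    (is "(\<forall>v. _ \<longrightarrow> measure M {\<omega> \<in> _. \<forall>v'. _ \<longrightarrow> ereal (sin_angle v v') \<le> ?bound \<omega>} \<ge> ?p) \<and> _")
proof (cases "\<delta> = 0")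
  case True
  interpret prob_space M by fact
  \<comment> \<open>With \<open>\<delta> = 0\<close> the first quotient is already infinite, so the
    event is the whole space and it remains to see that the claimed probability is at most
    1.\<close>
  have top: "?bound \<omega> = \<infinity>" for \<omega> using True by (simp add: equot_def)
  define p where "p = ?p"
  have "0 \<le> 54 * C\<^sub>1 * exp (- c\<^sub>1 * (\<delta> powr \<gamma> / 8 powr \<gamma>))"
    "0 \<le> 2 * C\<^sub>1 * 9 ^ (2 * r) * exp (- c\<^sub>1 * real r * (t powr \<gamma> / 4 powr \<gamma>))"
    using \<open>C\<^sub>1 > 0\<close> by simp_all
  then have "p \<le> 1" unfolding p_def by linarith
  then show ?thesis unfolding top p_def[symmetric] by (simp add: prob_space)
next
  case False
  then have \<delta>: "\<delta> > 0" using assms(8) singular_value_2_le_1[of A] by simp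
  note main = perturbation_bound_probability[OF assms(1-3,5-8) \<delta> assms(9)]
  show ?thesis
  proof (intro conjI allI impI)
    fix v assume "top_right_singular_vector A v"
    then obtain u where uv: "singular_pair A (singular_value A 1) u v" by (auto simp: top_right_singular_vector_def)
    have "continuous_on UNIV (\<lambda>p::(real^'m) \<times> (real^'n). sin_angle v (snd p))"
      unfolding sin_angle_def by (intro continuous_intros)
    note prob_ge = main[OF uv this]
    \<comment> \<open>Each top vector comes with some partner, so quantifying over vectors and over
      pairs is equivalent; the pair form is the one proved measurable.\<close>
    have top_iff: "(\<forall>v'. top_right_singular_vector B v' \<longrightarrow> Q v') \<longleftrightarrow>
        (\<forall>u' v'. singular_pair B (singular_value B 1) u' v' \<longrightarrow> Q v')" for B :: "real^'n^'m" and Q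
      unfolding top_right_singular_vector_def by blast
    show "measure M {\<omega> \<in> space M. \<forall>v'. top_right_singular_vector (A + E \<omega>) v' \<longrightarrow> ereal (sin_angle v v') \<le> ?bound \<omega>} \<ge> ?p"
      unfolding top_iff by (rule prob_ge) simp
  next
    fix u assume "top_left_singular_vector A u"
    then obtain v where uv: "singular_pair A (singular_value A 1) u v" by (auto simp: top_left_singular_vector_def)
    have "continuous_on UNIV (\<lambda>p::(real^'m) \<times> (real^'n). sin_angle u (fst p))"
      unfolding sin_angle_def by (intro continuous_intros)
    from main[OF uv this]
    show "measure M {\<omega> \<in> space M. \<forall>u'. top_left_singular_vector (A + E \<omega>) u' \<longrightarrow> ereal (sin_angle u u') \<le> ?bound \<omega>} \<ge> ?p"
      unfolding top_left_singular_vector_def by simp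
  qed
qed

end
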